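(* There is a universal constant $C>0$ such that the height of each of the matching polytope $M(K_n)$, the perfect matching polytope $PM(K_n)$, the fractional matching polytope $FM(K_n)$ and the fractional perfect matching polytope $FPM(K_n)$ of the complete graph $K_n$ is $> C\cdot\left\lfloor \frac n2-1\right\rfloor!$.
   Context: For a graph $G=(V,E)$, a matching is a set of edges such that every vertex meets at most one of them; it is perfect if every vertex meets exactly one. $M(G)$ (resp. $PM(G)$) is the convex hull in $\mathbb{R}^E$ of the 0/1 incidence vectors of the matchings (resp. perfect matchings) of $G$. $FM(G)=\{x\in\mathbb{R}^E: x\ge0,\ x(\delta(v))\le1\ \forall v\in V\}$ and $FPM(G)=\{x\in\mathbb{R}^E: x\ge 0,\ x(\delta(v))=1\ \forall v\in V\}$, where $x(\delta(v))$ is the sum of $x_e$ over edges $e$ incident to $v$. For a polytope $Q$, a linear objective $c$ (to be minimized) is nondegenerate if no two vertices have the same objective value; each edge of $Q$ is oriented toward its endpoint of smaller value. A $c$-monotone path is a directed path in this oriented graph from some vertex to the optimal vertex; its length is its number of edges. The height of $Q$ is the maximum length of a $c$-monotone path, over all nondegenerate $c$.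
   Formalization: The claim is stated for M and FM with n ≥ 2, for PM with even n ≥ 4, and for FPM with n ≥ 4, because PM(K_n) is empty for odd n, PM(K_2), FPM(K_2) and FPM(K_3) are single points of height 0 while the factorial is 1, and for n < 2 the factorial is undefined. *)

theory Defs
  imports "HOL-Analysis.Analysis" "HOL-Library.Function_Algebras"
begin

text \<open>
  The number of vertices of the graph varies inside the statement, so the coordinate
  spaces \<open>\<real>\<^sup>E\<close> cannot be given by an index type. Instead the functions from vertex sets to
  the reals are made into a real vector space, and \<open>\<real>\<^sup>E\<close> is the subspace of functions
  that vanish outside \<open>E\<close>. The library notions of convex hull, face, extreme point and
  linear map then apply directly.
\<close>

instantiation "fun" :: (type, real_vector) real_vector
begin

definition scaleR_fun :: "real \<Rightarrow> ('a \<Rightarrow> 'b) \<Rightarrow> 'a \<Rightarrow> 'b" where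
  "scaleR_fun r f = (\<lambda>x. r *\<^sub>R f x)"

instance
  by standard (simp_all add: fun_eq_iff scaleR_fun_def scaleR_add_right scaleR_add_left)

end


definition vertices :: "'a::real_vector set \<Rightarrow> 'a set" where
  "vertices Q = {v. v extreme_point_of Q}"

text \<open>
  Linear functionals on a subspace extend to the whole space, so quantifying over functionals
  on the ambient space is the same as quantifying over objectives in \<open>\<real>\<^sup>E\<close>.
\<close>

definition nondegenerate :: "'a::real_vector set \<Rightarrow> ('a \<Rightarrow> real) \<Rightarrow> bool" where
  "nondegenerate Q c \<longleftrightarrow> linear c \<and> inj_on c (vertices Q)"

text \<open>
  The library's \<open>edge_of\<close> (a face of affine dimension 1) requires a Euclidean space; for a
  polytope such a face is the segment joining two distinct vertices.
\<close>

definition adjacent :: "'a::real_vector set \<Rightarrow> 'a \<Rightarrow> 'a \<Rightarrow> bool" where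
  "adjacent Q u v \<longleftrightarrow>
     u \<in> vertices Q \<and> v \<in> vertices Q \<and> u \<noteq> v \<and> closed_segment u v face_of Q"

definition monotone_path :: "'a::real_vector set \<Rightarrow> ('a \<Rightarrow> real) \<Rightarrow> 'a list \<Rightarrow> bool" where
  "monotone_path Q c p \<longleftrightarrow>
     p \<noteq> [] \<and> set p \<subseteq> vertices Q \<and>
     successively (\<lambda>u v. adjacent Q u v \<and> c v < c u) p \<and>
     (\<forall>v \<in> vertices Q. c (last p) \<le> c v)"

text \<open>
  For a nonempty polytope the set below is finite and nonempty: the objective strictly
  decreases along a monotone path, so its vertices are distinct. For the empty set
  the height is unspecified.
\<close>

definition height :: "'a::real_vector set \<Rightarrow> nat" where
  "height Q = Max {length p - 1 | p c. nondegenerate Q c \<and> monotone_path Q c p}"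


definition matching :: "'v set \<Rightarrow> 'v set set \<Rightarrow> 'v set set \<Rightarrow> bool" where
  "matching V E M \<longleftrightarrow>
     M \<subseteq> E \<and> (\<forall>v \<in> V. \<forall>e \<in> M. \<forall>f \<in> M. v \<in> e \<longrightarrow> v \<in> f \<longrightarrow> e = f)"

definition perfect_matching :: "'v set \<Rightarrow> 'v set set \<Rightarrow> 'v set set \<Rightarrow> bool" where
  "perfect_matching V E M \<longleftrightarrow> M \<subseteq> E \<and> (\<forall>v \<in> V. \<exists>!e. e \<in> M \<and> v \<in> e)"

definition matching_polytope :: "'v set \<Rightarrow> 'v set set \<Rightarrow> ('v set \<Rightarrow> real) set" where
  "matching_polytope V E = convex hull {indicator M | M. matching V E M}"

definition perfect_matching_polytope :: "'v set \<Rightarrow> 'v set set \<Rightarrow> ('v set \<Rightarrow> real) set" where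
  "perfect_matching_polytope V E = convex hull {indicator M | M. perfect_matching V E M}"

definition coordinate_space :: "'v set set \<Rightarrow> ('v set \<Rightarrow> real) set" where
  "coordinate_space E = {x. \<forall>e. e \<notin> E \<longrightarrow> x e = 0}"

definition fractional_matching_polytope :: "'v set \<Rightarrow> 'v set set \<Rightarrow> ('v set \<Rightarrow> real) set" where
  "fractional_matching_polytope V E =
     {x \<in> coordinate_space E.
        (\<forall>e \<in> E. 0 \<le> x e) \<and> (\<forall>v \<in> V. (\<Sum>e \<in> {e \<in> E. v \<in> e}. x e) \<le> 1)}"

definition fractional_perfect_matching_polytope ::
    "'v set \<Rightarrow> 'v set set \<Rightarrow> ('v set \<Rightarrow> real) set" where
  "fractional_perfect_matching_polytope V E =
     {x \<in> coordinate_space E.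
        (\<forall>e \<in> E. 0 \<le> x e) \<and> (\<forall>v \<in> V. (\<Sum>e \<in> {e \<in> E. v \<in> e}. x e) = 1)}"

definition complete_edges :: "'v set \<Rightarrow> 'v set set" where
  "complete_edges V = {e. e \<subseteq> V \<and> card e = 2}"

definition M_K :: "nat \<Rightarrow> (nat set \<Rightarrow> real) set" where
  "M_K n = matching_polytope {..<n} (complete_edges {..<n})"

definition PM_K :: "nat \<Rightarrow> (nat set \<Rightarrow> real) set" where
  "PM_K n = perfect_matching_polytope {..<n} (complete_edges {..<n})"

definition FM_K :: "nat \<Rightarrow> (nat set \<Rightarrow> real) set" where
  "FM_K n = fractional_matching_polytope {..<n} (complete_edges {..<n})"

definition FPM_K :: "nat \<Rightarrow> (nat set \<Rightarrow> real) set" where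
  "FPM_K n = fractional_perfect_matching_polytope {..<n} (complete_edges {..<n})"

end

(*
  Fix the perfect matchings of an even complete graph on {0, ..., 2k - 1}, and give the edge with
  endpoints i < j a weight that is a power of two, lexicographic in i (ascending) and then in j, so
  that the partner of the smallest vertex dominates the cost. Call two perfect matchings linked if their
  union is connected, i.e. a Hamiltonian cycle; then they span an edge of the polytope.

  By induction on k, every perfect matching R is followed by some descending path of at least
  2^(k-1) (k-1)! perfect matchings that starts at a matching linked to R and ends at the optimum: let the
  partner p of the smallest vertex a run downwards through all other vertices (skipping at most one). To
  enter the block of p from R, with edges {a, q} and {p, r} in R, contract the path q - a - p - r to an
  edge {q, r}, apply the induction hypothesis on the remaining vertices, and add {a, p}.

  All four polytopes lie in the fractional matching polytope and contain these points, once three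
  left-over vertices are filled with a half-integral triangle if necessary. It therefore suffices to
  exhibit the faces of that polytope. An explicit dual solution shows that the last matching is the unique minimum
  of the objective on the fractional matching polytope, and a small perturbation makes the objective
  nondegenerate.
*)

theory Submission
  imports Defs
begin

section \<open>Generic objectives and the height\<close>

lemma exists_linear_functional_nonzero:
  fixes v :: "'a::real_vector"
  assumes "v \<noteq> 0"
  obtains f :: "'a \<Rightarrow> real" where "linear f" "f v \<noteq> 0"
proof -
  have "independent {v}"
    using assms by (simp add: dependent_single)
  then obtain f :: "'a \<Rightarrow> real" where "linear f" "\<forall>x\<in>{v}. f x = 1"
    using linear_independent_extend[of "{v}" "\<lambda>_. 1::real"] by blast
  then show ?thesis
    using that by auto
qed

text \<open>The conditions are strict and finite in number, hence stable under small perturbations.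
  The vectors of \<open>D\<close> are treated one at a time: a small positive multiple of a
  functional that does not vanish at \<open>d\<close> is added.\<close>

lemma perturb_functional:
  fixes c :: "'a::real_vector \<Rightarrow> real"
  assumes "finite D" "finite A" "linear c" "\<And>d. d \<in> A \<Longrightarrow> c d > 0" "0 \<notin> D"
  shows "\<exists>c'::'a \<Rightarrow> real. linear c' \<and> (\<forall>d\<in>A. c' d > 0) \<and> (\<forall>d\<in>D. c' d \<noteq> 0)"
  using assms(1,5)
proof (induction D rule: finite_induct)
  case empty
  then show ?case using assms by auto
next
  case (insert d D)
  then obtain c' :: "'a \<Rightarrow> real" where
    c': "linear c'" "\<forall>d\<in>A. c' d > 0" "\<forall>d\<in>D. c' d \<noteq> 0"
    by auto
  obtain g :: "'a \<Rightarrow> real" where g: "linear g" "g d \<noteq> 0"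
    using exists_linear_functional_nonzero[of d] insert.prems by auto
  have lim: "((\<lambda>t. c' x + t * g x) \<longlongrightarrow> c' x) (at_right 0)" for x
    by (auto intro!: tendsto_eq_intros)
  have pos: "eventually (\<lambda>t. c' x + t * g x > 0) (at_right 0)" if "x \<in> A" for x
    using order_tendstoD(1)[OF lim] c' that by blast
  have ne: "eventually (\<lambda>t. c' x + t * g x \<noteq> 0) (at_right 0)" if "c' x \<noteq> 0" for x
    using tendsto_imp_eventually_ne[OF lim] that by blast
  have "eventually (\<lambda>t. c' d + t * g d \<noteq> 0) (at_right 0)"
  proof (cases "c' d = 0")
    case True
    then show ?thesis
      using g eventually_at_right_less[of "0::real"] by (auto elim!: eventually_mono)
  qed (use ne in blast)
  moreover have "eventually (\<lambda>t. \<forall>x\<in>A. c' x + t * g x > 0) (at_right 0)"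
    using pos \<open>finite A\<close> by (intro eventually_ball_finite) auto
  moreover have "eventually (\<lambda>t. \<forall>x\<in>D. c' x + t * g x \<noteq> 0) (at_right 0)"
    using ne c' insert.hyps by (intro eventually_ball_finite) auto
  ultimately have "eventually (\<lambda>t. c' d + t * g d \<noteq> 0 \<and> (\<forall>x\<in>A. c' x + t * g x > 0) \<and>
      (\<forall>x\<in>D. c' x + t * g x \<noteq> 0)) (at_right 0)"
    by (intro eventually_conj)
  then obtain t where "c' d + t * g d \<noteq> 0" "\<forall>x\<in>A. c' x + t * g x > 0"
    "\<forall>x\<in>D. c' x + t * g x \<noteq> 0"
    using eventually_happens'[OF trivial_limit_at_right_real] by blast
  moreover have "linear (\<lambda>x. c' x + t * g x)"
    using c' g by (intro linearI) (auto simp: linear_add linear_cmul algebra_simps)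
  ultimately show ?case
    by (intro exI[of _ "\<lambda>x. c' x + t * g x"]) auto
qed

text \<open>This frees the later constructions from nondegeneracy: \<open>c\<close> may have ties,
  as long as it decreases strictly along \<open>p\<close> and has its unique minimum over the
  vertices at \<open>last p\<close>. A perturbation keeps all strict comparisons between vertices
  and breaks the ties.\<close>

lemma height_ge:
  fixes Q :: "'a::real_vector set" and c :: "'a \<Rightarrow> real"
  assumes fin: "finite (vertices Q)" and lin: "linear c"
    and p: "p \<noteq> []" "set p \<subseteq> vertices Q"
    and adj: "successively (\<lambda>u v. adjacent Q u v \<and> c v < c u) p"
    and opt: "\<And>v. v \<in> vertices Q \<Longrightarrow> v \<noteq> last p \<Longrightarrow> c (last p) < c v"
  shows "length p - 1 \<le> height Q"
proof -
  \<comment> \<open>\<open>A\<close> holds the differences whose sign must survive the perturbation,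
    \<open>D\<close> those that must get a nonzero value.\<close>
  define A where "A = {u - v | u v. u \<in> vertices Q \<and> v \<in> vertices Q \<and> c v < c u}"
  define D where "D = {u - v | u v. u \<in> vertices Q \<and> v \<in> vertices Q \<and> u \<noteq> v}"
  have sub: "A \<subseteq> (\<lambda>(u, v). u - v) ` (vertices Q \<times> vertices Q)"
    "D \<subseteq> (\<lambda>(u, v). u - v) ` (vertices Q \<times> vertices Q)"
    unfolding A_def D_def by auto
  have "finite A" "finite D"
    using finite_subset[OF sub(1)] finite_subset[OF sub(2)] fin by auto
  moreover have "c d > 0" if "d \<in> A" for d
    using that lin by (auto simp: A_def linear_diff)
  moreover have "0 \<notin> D"
    by (auto simp: D_def)
  ultimately obtain c' :: "'a \<Rightarrow> real"
    where c': "linear c'" "\<forall>d\<in>A. c' d > 0" "\<forall>d\<in>D. c' d \<noteq> 0"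
    using perturb_functional[of D A c] lin by blast
  have dec: "c' v < c' u" if "u \<in> vertices Q" "v \<in> vertices Q" "c v < c u" for u v
  proof -
    have "u - v \<in> A"
      using that unfolding A_def by blast
    then show ?thesis
      using c' by (auto simp: linear_diff)
  qed
  have nd: "nondegenerate Q c'"
    unfolding nondegenerate_def
  proof (intro conjI inj_onI)
    fix u v assume uv: "u \<in> vertices Q" "v \<in> vertices Q" "c' u = c' v"
    show "u = v"
    proof (rule ccontr)
      assume "u \<noteq> v"
      then have "u - v \<in> D"
        using uv unfolding D_def by blast
      then show False
        using uv c' by (auto simp: linear_diff)
    qed
  qed (fact c')
  have "monotone_path Q c' p"
    unfolding monotone_path_def
  proof (intro conjI ballI)
    show "successively (\<lambda>u v. adjacent Q u v \<and> c' v < c' u) p"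
      using adj by (rule successively_mono) (auto simp: adjacent_def dec)
    show "c' (last p) \<le> c' v" if "v \<in> vertices Q" for v
      using dec[of v "last p"] opt[of v] that p by (cases "v = last p") force+
  qed (use p in auto)
  with nd have mem: "length p - 1 \<in> {length p - 1 | p c. nondegenerate Q c \<and> monotone_path Q c p}"
    by blast
  \<comment> \<open>\<open>Max\<close> is informative only on a finite set. The objective drops
    strictly, so a monotone path never repeats a vertex and its length is bounded.\<close>
  have len: "length q \<le> card (vertices Q)" if "monotone_path Q f q" for q and f :: "'a \<Rightarrow> real"
  proof -
    have "successively (\<lambda>u v. f v < f u) q"
      using that unfolding monotone_path_def by (auto elim: successively_mono)
    then have "sorted_wrt (\<lambda>u v. f v < f u) q"
      by (subst (asm) successively_conv_sorted_wrt) (auto intro: transpI)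
    then have "distinct q"
      by (induction q) auto
    then show ?thesis
      using that fin card_mono[OF fin] distinct_card[of q]
      unfolding monotone_path_def by metis
  qed
  have "{length p - 1 | p c. nondegenerate Q c \<and> monotone_path Q c p} \<subseteq> {..card (vertices Q)}"
    using len by (fastforce intro: le_trans[OF diff_le_self])
  then show ?thesis
    unfolding height_def by (intro Max_ge mem) (auto intro: finite_subset)
qed

section \<open>Perfect matchings and a lexicographic cost\<close>

abbreviation pm :: "nat set \<Rightarrow> nat set set \<Rightarrow> bool" where
  "pm V M \<equiv> perfect_matching V (complete_edges V) M"

text \<open>
  Constancy on \<open>U\<close> of every function that is constant on edges says that \<open>U\<close> lies in one component
  of the graph \<open>M \<union> M'\<close>. This form is immediate to use for adjacency, where \<open>\<alpha> v\<close> is the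
  value of a point of the face on the edge of \<open>M\<close> at \<open>v\<close>.
\<close>

definition linked :: "nat set \<Rightarrow> nat set set \<Rightarrow> nat set set \<Rightarrow> bool" where
  "linked U M M' \<longleftrightarrow> (\<forall>\<alpha> :: nat \<Rightarrow> real.
     (\<forall>e \<in> M \<union> M'. \<forall>u \<in> e. \<forall>v \<in> e. \<alpha> u = \<alpha> v) \<longrightarrow> (\<forall>u \<in> U. \<forall>v \<in> U. \<alpha> u = \<alpha> v))"

section \<open>Adding, removing and contracting edges of perfect matchings\<close>

lemma pm_edgeE:
  assumes "pm V M" "v \<in> V"
  obtains u where "{v, u} \<in> M" "u \<in> V" "u \<noteq> v"
proof -
  obtain e where e: "e \<in> M" "v \<in> e"
    using assms unfolding perfect_matching_def by blast
  then have "e \<subseteq> V" "card e = 2"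
    using assms unfolding perfect_matching_def complete_edges_def by blast+
  then obtain x y where "e = {x, y}" "x \<noteq> y"
    by (auto simp: card_2_iff)
  then show ?thesis
    using e \<open>e \<subseteq> V\<close> that by (cases "v = x") (auto simp: insert_commute)
qed

lemma pm_edge_subset: "pm V M \<Longrightarrow> e \<in> M \<Longrightarrow> e \<subseteq> V"
  and pm_edge_card: "pm V M \<Longrightarrow> e \<in> M \<Longrightarrow> card e = 2"
  unfolding perfect_matching_def complete_edges_def by blast+

lemma pm_edge_unique:
  "pm V M \<Longrightarrow> e \<in> M \<Longrightarrow> f \<in> M \<Longrightarrow> v \<in> e \<Longrightarrow> v \<in> f \<Longrightarrow> e = f"
  using pm_edge_subset[of V M e] unfolding perfect_matching_def by blast

lemma pm_finite: "finite V \<Longrightarrow> pm V M \<Longrightarrow> finite M"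
  by (rule finite_subset[of M "Pow V"]) (use pm_edge_subset in auto)

lemma pm_insert_edge:
  assumes "pm (V - {a, p}) X" "a \<in> V" "p \<in> V" "a \<noteq> p"
  shows "pm V (insert {a, p} X)" and "{a, p} \<notin> X"
proof -
  have sub: "e \<subseteq> V - {a, p}" if "e \<in> X" for e
    using pm_edge_subset assms(1) that .
  then show "{a, p} \<notin> X"
    by blast
  show "pm V (insert {a, p} X)"
    unfolding perfect_matching_def
  proof (intro conjI ballI)
    show "insert {a, p} X \<subseteq> complete_edges V"
      using assms sub pm_edge_card[OF assms(1)] by (auto simp: complete_edges_def)
    fix v assume v: "v \<in> V"
    show "\<exists>!e. e \<in> insert {a, p} X \<and> v \<in> e"
    proof (cases "v \<in> {a, p}")
      case True
      then show ?thesis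
        using sub by (intro ex1I[of _ "{a, p}"]) blast+
    next
      case False
      then have "\<exists>!e. e \<in> X \<and> v \<in> e"
        using v assms(1) unfolding perfect_matching_def by blast
      then show ?thesis
        using False by auto
    qed
  qed
qed

lemma pm_remove_edge:
  assumes "pm V M" "{a, p} \<in> M"
  shows "pm (V - {a, p}) (M - {{a, p}})"
  unfolding perfect_matching_def
proof (intro conjI ballI)
  show "M - {{a, p}} \<subseteq> complete_edges (V - {a, p})"
  proof
    fix e assume e: "e \<in> M - {{a, p}}"
    then have "a \<notin> e" "p \<notin> e"
      using pm_edge_unique[OF assms(1) _ assms(2), of e] by auto
    then show "e \<in> complete_edges (V - {a, p})"
      using e pm_edge_subset[OF assms(1)] pm_edge_card[OF assms(1)]
      by (auto simp: complete_edges_def)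
  qed
  fix v assume v: "v \<in> V - {a, p}"
  then have "\<exists>!e. e \<in> M \<and> v \<in> e"
    using assms(1) unfolding perfect_matching_def by blast
  then show "\<exists>!e. e \<in> M - {{a, p}} \<and> v \<in> e"
    using v by auto
qed

text \<open>\<open>R'\<close> arises from \<open>R\<close> by contracting the path \<open>q - a - p - r\<close> to the edge \<open>{q, r}\<close>.\<close>

lemma linked_insert_edge:
  assumes R: "pm V R" and a: "a \<in> V" and p: "p \<in> V" "p \<noteq> a" "{a, p} \<notin> R"
  obtains R' where "pm (V - {a, p}) R'"
    "\<And>Z. linked (V - {a, p}) R' Z \<Longrightarrow> linked V R (insert {a, p} Z)"
proof -
  obtain q where q: "{a, q} \<in> R" "q \<in> V" "q \<noteq> a"
    using pm_edgeE[OF R a] by auto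
  obtain r where r: "{p, r} \<in> R" "r \<in> V" "r \<noteq> p"
    using pm_edgeE[OF R p(1)] by auto
  have "q \<noteq> p" "r \<noteq> a"
    using q r p by (auto simp: insert_commute)
  have "q \<noteq> r"
    using pm_edge_unique[OF R q(1) r(1), of q] p \<open>q \<noteq> p\<close> by (auto simp: doubleton_eq_iff)
  define R0 where "R0 = R - {{a, q}} - {{p, r}}"
  define V0 where "V0 = V - {a, q} - {p, r}"
  have "{p, r} \<in> R - {{a, q}}"
    using r p \<open>q \<noteq> p\<close> by (auto simp: doubleton_eq_iff)
  then have "pm V0 R0"
    unfolding V0_def R0_def by (intro pm_remove_edge R q)
  moreover have "V0 = V - {a, p} - {q, r}"
    unfolding V0_def by auto
  ultimately have "pm (V - {a, p} - {q, r}) R0"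
    by (simp only:)
  then have pm': "pm (V - {a, p}) (insert {q, r} R0)"
    by (rule pm_insert_edge(1)) (use q r \<open>q \<noteq> r\<close> \<open>q \<noteq> p\<close> \<open>r \<noteq> a\<close> in simp_all)
  have "linked V R (insert {a, p} Z)"
    if Z: "linked (V - {a, p}) (insert {q, r} R0) Z" for Z
    unfolding linked_def
  proof (intro allI impI)
    fix \<alpha> :: "nat \<Rightarrow> real"
    assume \<alpha>: "\<forall>e\<in>R \<union> insert {a, p} Z. \<forall>u\<in>e. \<forall>v\<in>e. \<alpha> u = \<alpha> v"
    \<comment> \<open>\<open>\<alpha>\<close> takes a single value along the path q - a - p - r. It
      is therefore constant on the contracted edge as well, and linkage of the smaller matchings
      applies.\<close>
    have eq: "\<alpha> a = \<alpha> q" "\<alpha> p = \<alpha> r" "\<alpha> a = \<alpha> p"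
    proof -
      have "\<alpha> u = \<alpha> v" if "{u, v} \<in> R \<union> insert {a, p} Z" for u v
        using \<alpha> that by (meson insertCI)
      then show "\<alpha> a = \<alpha> q" "\<alpha> p = \<alpha> r" "\<alpha> a = \<alpha> p"
        using q(1) r(1) by auto
    qed
    have "\<forall>e\<in>insert {q, r} R0 \<union> Z. \<forall>u\<in>e. \<forall>v\<in>e. \<alpha> u = \<alpha> v"
      using \<alpha> eq by (auto simp: R0_def)
    then have "\<forall>u\<in>V - {a, p}. \<forall>v\<in>V - {a, p}. \<alpha> u = \<alpha> v"
      using Z unfolding linked_def by blast
    moreover have "q \<in> V - {a, p}"
      using q \<open>q \<noteq> p\<close> by auto
    ultimately have "\<alpha> v = \<alpha> q" if "v \<in> V" for v
      using that eq by (metis Diff_iff insertE singletonD)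
    then show "\<forall>u\<in>V. \<forall>v\<in>V. \<alpha> u = \<alpha> v"
      by metis
  qed
  with pm' show ?thesis
    by (rule that)
qed

section \<open>Lexicographic weights: the partner of the smallest vertex decides\<close>

definition weight :: "nat \<Rightarrow> nat set \<Rightarrow> real" where
  "weight N e = 2 ^ (N * (N - Min e) + Max e)"

definition cost :: "nat \<Rightarrow> nat set set \<Rightarrow> real" where
  "cost N M = (\<Sum>e\<in>M. weight N e)"

text \<open>Division by \<open>N\<close> recovers \<open>N - Min e\<close> as the quotient and
  \<open>Max e\<close> as the remainder, because \<open>Max e < N\<close>. Distinct edges thus get
  distinct powers of two.\<close>

lemma inj_on_weight_exponent:
  fixes N :: nat
  shows
  "inj_on (\<lambda>e. N * (N - Min e) + Max e) (complete_edges {..<N})"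
proof (rule inj_onI)
  fix e f assume ef: "e \<in> complete_edges {..<N}" "f \<in> complete_edges {..<N}"
    and eq: "N * (N - Min e) + Max e = N * (N - Min f) + Max f"
  have *: "Min e < N \<and> Max e < N \<and> e = {Min e, Max e}" if "e \<in> complete_edges {..<N}" for e
  proof -
    have "e \<subseteq> {..<N}" "card e = 2"
      using that by (auto simp: complete_edges_def)
    then obtain x y where "e = {x, y}" "x < N" "y < N"
      by (auto simp: card_2_iff)
    then show ?thesis
      by (cases "x \<le> y") (auto simp: min_def max_def)
  qed
  have "(N * (N - Min e) + Max e) div N = N - Min e" "(N * (N - Min e) + Max e) mod N = Max e"
    "(N * (N - Min f) + Max f) div N = N - Min f" "(N * (N - Min f) + Max f) mod N = Max f"
    using *[OF ef(1)] *[OF ef(2)] by auto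
  then have "N - Min e = N - Min f" "Max e = Max f"
    using eq by metis+
  then have "Min e = Min f"
    using *[OF ef(1)] *[OF ef(2)] by linarith
  then show "e = f"
    using *[OF ef(1)] *[OF ef(2)] \<open>Max e = Max f\<close> by metis
qed

text \<open>Distinct powers of two with exponents below \<open>m\<close> sum to less than
  \<open>2 ^ m\<close>. Here all exponents lie below \<open>N * (N - a)\<close>, since
  \<open>Min e\<close> exceeds \<open>a\<close> and \<open>Max e < N\<close>.\<close>

lemma cost_less_power:
  fixes N a :: nat
  assumes "X \<subseteq> complete_edges {..<N}" "\<And>e. e \<in> X \<Longrightarrow> a < Min e"
  shows "cost N X < 2 ^ (N * (N - a))"
proof -
  let ?r = "\<lambda>e. N * (N - Min e) + Max e"
  have "cost N X = (\<Sum>i\<in>?r ` X. 2 ^ i)"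
    unfolding cost_def weight_def
    by (subst sum.reindex) (auto intro: inj_on_subset[OF inj_on_weight_exponent assms(1)])
  also have "\<dots> \<le> (\<Sum>i<N * (N - a). 2 ^ i)"
  proof (intro sum_mono2)
    show "?r ` X \<subseteq> {..<N * (N - a)}"
    proof (rule image_subsetI)
      fix e assume e: "e \<in> X"
      then have "e \<subseteq> {..<N}" "card e = 2"
        using assms(1) by (auto simp: complete_edges_def)
      moreover from this have "finite e" "e \<noteq> {}"
        by (auto intro: card_ge_0_finite)
      ultimately have "Max e < N" "Min e < N"
        by (auto simp: subset_iff)
      moreover have "N - Min e + 1 \<le> N - a"
        using assms(2)[OF e] \<open>Min e < N\<close> by linarith
      then have "N * (N - Min e + 1) \<le> N * (N - a)"
        by (rule mult_le_mono2)
      ultimately show "N * (N - Min e) + Max e \<in> {..<N * (N - a)}"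
        by simp
    qed
  qed auto
  also have "\<dots> < 2 ^ (N * (N - a))"
    by (simp add: power_diff_1_eq[of "2::real", simplified, symmetric])
  finally show ?thesis .
qed

text \<open>All edges of \<open>X\<close> avoid \<open>a\<close>, so together they weigh less than
  \<open>{a, p}\<close>, and the first cost is less than twice the weight of that edge. Doubling
  raises the exponent by one, which \<open>p < q\<close> absorbs.\<close>

lemma cost_less_of_partner:
  assumes X: "pm (V - {a, p}) X" and Y: "pm (V - {a, q}) Y"
    and V: "V \<subseteq> {..<N}" "a \<in> V" "\<And>v. v \<in> V \<Longrightarrow> a \<le> v"
    and pq: "p \<in> V" "q \<in> V" "a \<noteq> p" "p < q"
  shows "cost N (insert {a, p} X) < cost N (insert {a, q} Y)"
proof -
  have fin: "finite V"
    using V finite_subset by blast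
  have "a < p" "a < q"
    using V(3)[OF pq(1)] pq by linarith+
  have X': "a < Min e" if "e \<in> X" for e
  proof -
    have "e \<subseteq> V - {a, p}" "finite e" "e \<noteq> {}"
      using pm_edge_subset[OF X that] pm_edge_card[OF X that] by (auto intro: card_ge_0_finite)
    then show "a < Min e"
      using V(3) by (subst Min_gr_iff) (auto simp: subset_iff less_le)
  qed
  have "cost N X < 2 ^ (N * (N - a))"
  proof (rule cost_less_power)
    show "X \<subseteq> complete_edges {..<N}"
      using X V by (auto simp: perfect_matching_def complete_edges_def)
  qed (use X' in blast)
  also have "\<dots> \<le> 2 ^ (N * (N - a) + p)"
    by (intro power_increasing) auto
  finally have "cost N (insert {a, p} X) < 2 ^ (N * (N - a) + p) + 2 ^ (N * (N - a) + p)"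
    using pm_insert_edge(2)[OF X V(2) pq(1)] pq pm_finite[OF _ X] fin \<open>a < p\<close>
    by (simp add: cost_def weight_def)
  also have "\<dots> = 2 ^ (N * (N - a) + Suc p)"
    by simp
  also have "\<dots> \<le> 2 ^ (N * (N - a) + q)"
    using pq by (intro power_increasing) auto
  also have "\<dots> \<le> cost N (insert {a, q} Y)"
    using pm_insert_edge(2)[OF Y V(2) pq(2)] pq pm_finite[OF _ Y] fin \<open>a < q\<close>
    by (auto simp: cost_def weight_def intro!: sum_nonneg)
  finally show ?thesis .
qed

section \<open>Long descending paths of perfect matchings\<close>

lemma linked_mono: "linked U M M' \<Longrightarrow> U' \<subseteq> U \<Longrightarrow> M \<subseteq> N \<Longrightarrow> M' \<subseteq> N' \<Longrightarrow> linked U' N N'"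
  unfolding linked_def by (meson Un_mono subsetD)

text \<open>For perfect matchings, linkage on the vertices where they differ says that the symmetric
  difference is a single alternating cycle. Linkage on the whole vertex set would be too much to
  ask: the matchings of one block share the edge \<open>{a, p}\<close>.\<close>

abbreviation descends :: "nat \<Rightarrow> nat set set \<Rightarrow> nat set set \<Rightarrow> bool" where
  "descends N M M' \<equiv> linked (\<Union>(M - M')) M M' \<and> cost N M' < cost N M"

text \<open>\<open>R\<close> is the matching from which the path is entered. Its cost is not
  compared with that of \<open>hd P\<close>, so the induction hypothesis applies to any contracted
  matching.\<close>

definition descending_path :: "nat \<Rightarrow> nat set \<Rightarrow> nat set set \<Rightarrow> nat set set list \<Rightarrow> bool" where
  "descending_path N V R P \<longleftrightarrow>
     P \<noteq> [] \<and> (\<forall>M \<in> set P. pm V M) \<and> successively (descends N) P \<and> linked V R (hd P)"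

text \<open>A common new edge shifts all costs by the same constant and leaves the symmetric
  differences unchanged.\<close>

lemma descending_path_insert_edge:
  assumes P: "descending_path N (V - {a, p}) R' P"
    and V: "finite V" "a \<in> V" "p \<in> V" "a \<noteq> p"
    and R: "\<And>Z. linked (V - {a, p}) R' Z \<Longrightarrow> linked V R (insert {a, p} Z)"
  shows "descending_path N V R (map (insert {a, p}) P)"
proof -
  have pm': "pm (V - {a, p}) M" if "M \<in> set P" for M
    using P that by (auto simp: descending_path_def)
  have cost: "cost N (insert {a, p} M) = weight N {a, p} + cost N M" if "M \<in> set P" for M
    using pm_insert_edge(2)[OF pm'[OF that] V(2-4)] pm_finite[OF _ pm'[OF that]] V(1)
    by (simp add: cost_def)
  have "successively (\<lambda>M M'. descends N (insert {a, p} M) (insert {a, p} M')) P"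
  proof (rule successively_mono)
    show "successively (descends N) P"
      using P by (simp add: descending_path_def)
    fix M M' assume M: "M \<in> set P" "M' \<in> set P" "descends N M M'"
    have "linked (\<Union>(insert {a, p} M - insert {a, p} M')) (insert {a, p} M) (insert {a, p} M')"
      by (rule linked_mono[of "\<Union>(M - M')" M M']) (use M in auto)
    then show "descends N (insert {a, p} M) (insert {a, p} M')"
      using M cost by simp
  qed
  then have "successively (descends N) (map (insert {a, p}) P)"
    by (simp add: successively_map)
  moreover have "linked V R (hd (map (insert {a, p}) P))"
    using P R by (simp add: descending_path_def hd_map)
  ultimately show ?thesis
    using P pm_insert_edge(1)[OF pm' V(2-4)] by (auto simp: descending_path_def)
qed

lemma descending_path_append:
  assumes "descending_path N V R P" "descending_path N V (last P) Q"
    "cost N (hd Q) < cost N (last P)"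
  shows "descending_path N V R (P @ Q)"
proof -
  have "pm V (last P)"
    using assms(1) by (auto simp: descending_path_def)
  then have "\<Union>(last P - hd Q) \<subseteq> V"
    using pm_edge_subset by blast
  then have "linked (\<Union>(last P - hd Q)) (last P) (hd Q)"
    using assms(2) by (auto simp: descending_path_def intro: linked_mono)
  then show ?thesis
    using assms by (auto simp: descending_path_def successively_append_iff)
qed

text \<open>Induction on the list of partners of \<open>a\<close>: each partner contributes a block
  of at least \<open>L\<close> matchings, and the last matching of a block is the entry
  \<open>R\<close> of the next. The edges of \<open>a\<close> in the first and last matching are
  recorded to compare costs at the seams and at the end.\<close>

lemma descending_path_blocks:
  assumes V: "V \<subseteq> {..<N}" "a \<in> V" "\<And>v. v \<in> V \<Longrightarrow> a \<le> v"
    and block: "\<And>p R'. p \<in> V - {a} \<Longrightarrow> pm (V - {a, p}) R' \<Longrightarrow>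
      \<exists>P. descending_path N (V - {a, p}) R' P \<and> L \<le> length P \<and>
        (\<forall>X. pm (V - {a, p}) X \<longrightarrow> cost N (last P) \<le> cost N X)"
  shows "ps \<noteq> [] \<Longrightarrow> sorted_wrt (>) ps \<Longrightarrow> set ps \<subseteq> V - {a} \<Longrightarrow> pm V R \<Longrightarrow> {a, hd ps} \<notin> R \<Longrightarrow>
    \<exists>P. descending_path N V R P \<and> length ps * L \<le> length P \<and> {a, hd ps} \<in> hd P \<and>
      (\<forall>X. pm (V - {a, last ps}) X \<longrightarrow> cost N (last P) \<le> cost N (insert {a, last ps} X)) \<and>
      {a, last ps} \<in> last P"
proof (induction ps arbitrary: R)
  case (Cons p ps)
  have fin: "finite V"
    using V(1) finite_subset by blast
  have p: "p \<in> V" "p \<noteq> a" "{a, p} \<notin> R"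
    using Cons.prems by auto
  obtain R' where R': "pm (V - {a, p}) R'"
    "\<And>Z. linked (V - {a, p}) R' Z \<Longrightarrow> linked V R (insert {a, p} Z)"
    using linked_insert_edge[OF Cons.prems(4) V(2) p] by blast
  obtain P' where P': "descending_path N (V - {a, p}) R' P'" "L \<le> length P'"
    "\<And>X. pm (V - {a, p}) X \<Longrightarrow> cost N (last P') \<le> cost N X"
    using block[of p R'] R'(1) p by auto
  have ne: "P' \<noteq> []" and pmP': "\<And>M. M \<in> set P' \<Longrightarrow> pm (V - {a, p}) M"
    using P'(1) by (auto simp: descending_path_def)
  define P where "P = map (insert {a, p}) P'"
  have P: "descending_path N V R P"
    unfolding P_def by (rule descending_path_insert_edge[OF P'(1) fin V(2) p(1)]) (use p R' in auto)
  have hdP: "{a, p} \<in> hd P" and lastP: "last P = insert {a, p} (last P')"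
    using ne by (auto simp: P_def hd_map last_map)
  have cost: "cost N (insert {a, p} M) = weight N {a, p} + cost N M" if "pm (V - {a, p}) M" for M
    using pm_insert_edge(2)[OF that V(2) p(1)] p pm_finite[OF _ that] fin by (simp add: cost_def)
  have opt: "cost N (last P) \<le> cost N (insert {a, p} X)" if "pm (V - {a, p}) X" for X
    using P'(3)[OF that] cost[OF that] cost[OF pmP'[of "last P'"]] ne lastP by simp
  show ?case
  proof (cases "ps = []")
    case True
    then show ?thesis
      using P hdP lastP opt P'(2) by (intro exI[of _ P]) (auto simp: P_def)
  next
    case False
    have pmlast: "pm V (last P)"
      using P by (auto simp: descending_path_def)
    have hd_less: "hd ps < p" "hd ps \<in> V" "hd ps \<noteq> a"
      using Cons.prems False by (cases ps; auto)+
    \<comment> \<open>In the last matching of this block \<open>a\<close> is matched to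
      \<open>p\<close>, so the contraction that enters the next block is possible.\<close>
    have "{a, hd ps} \<notin> last P"
      using pm_edge_unique[OF pmlast, of "{a, hd ps}" "{a, p}" a] hd_less lastP
      by (auto simp: doubleton_eq_iff)
    then obtain Q where Q: "descending_path N V (last P) Q" "length ps * L \<le> length Q"
      "{a, hd ps} \<in> hd Q"
      "\<And>X. pm (V - {a, last ps}) X \<Longrightarrow> cost N (last Q) \<le> cost N (insert {a, last ps} X)"
      "{a, last ps} \<in> last Q"
      using Cons.IH[of "last P"] Cons.prems False pmlast by auto
    have neQ: "Q \<noteq> []" and "pm V (hd Q)"
      using Q(1) by (auto simp: descending_path_def)
    have "pm (V - {a, hd ps}) (hd Q - {{a, hd ps}})"
      by (rule pm_remove_edge) fact+
    \<comment> \<open>The cost drops at the seam whatever the other edges are, because the partner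
      of \<open>a\<close> decreases from \<open>p\<close> to \<open>hd ps\<close>.\<close>
    then have "cost N (insert {a, hd ps} (hd Q - {{a, hd ps}})) < cost N (insert {a, p} (last P'))"
      using ne hd_less p V by (intro cost_less_of_partner[where V = V] pmP') auto
    then have "cost N (hd Q) < cost N (last P)"
      using Q(3) lastP by (simp add: insert_absorb)
    then have "descending_path N V R (P @ Q)"
      using P Q by (intro descending_path_append)
    moreover have "P \<noteq> []"
      using ne by (simp add: P_def)
    ultimately show ?thesis
      using Q neQ hdP P'(2) False by (intro exI[of _ "P @ Q"]) (auto simp: P_def)
  qed
qed simp

lemma last_le_if_sorted_wrt_greater:
  fixes xs :: "nat list"
  shows "sorted_wrt (>) xs \<Longrightarrow> v \<in> set xs \<Longrightarrow> last xs \<le> v"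
  by (induction xs) (auto simp: less_imp_le)

text \<open>In the induction step \<open>a\<close> has \<open>2 * k + 3\<close> possible partners,
  of which at most one is skipped. The remaining \<open>2 * k + 2\<close> or more blocks, each of
  length at least \<open>2 ^ k * fact k\<close>, give the next value of the bound.\<close>

lemma descending_path_exists:
  assumes "V \<subseteq> {..<N}" "card V = 2 * Suc k" "pm V R"
  shows "\<exists>P. descending_path N V R P \<and> 2 ^ k * fact k \<le> length P \<and>
    (\<forall>X. pm V X \<longrightarrow> cost N (last P) \<le> cost N X)"
  using assms
proof (induction k arbitrary: V R)
  case 0
  then have "card V = 2"
    by simp
  have *: "X = {V}" if "pm V X" for X
  proof -
    have "complete_edges V = {V}"
      using 0 \<open>card V = 2\<close> card_subset_eq[of V]
      by (auto simp: complete_edges_def intro: finite_subset)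
    moreover have "X \<noteq> {}"
      using that \<open>card V = 2\<close> pm_edgeE[OF that] by (cases "V = {}") auto
    ultimately show ?thesis
      using that unfolding perfect_matching_def by auto
  qed
  have "linked V R R"
    using *[OF 0(3)] unfolding linked_def by blast
  then have "descending_path N V R [R]"
    using 0(3) by (simp add: descending_path_def)
  moreover have "cost N (last [R]) \<le> cost N X" if "pm V X" for X
    using *[OF that] *[OF 0(3)] by simp
  ultimately show ?case
    by (intro exI[of _ "[R]"]) simp
next
  case (Suc k)
  have fin: "finite V" and ne: "V \<noteq> {}"
    using Suc.prems finite_subset by auto
  define a where "a = Min V"
  have a: "a \<in> V" "\<And>v. v \<in> V \<Longrightarrow> a \<le> v"
    using fin ne by (auto simp: a_def)
  obtain q where q: "{a, q} \<in> R" "q \<in> V" "q \<noteq> a"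
    using pm_edgeE[OF Suc.prems(3) a(1)] by auto
  define s where "s = rev (sorted_list_of_set (V - {a}))"
  have s: "set s = V - {a}" "sorted_wrt (>) s" "length s = 2 * k + 3"
    using fin a Suc.prems(2) by (auto simp: s_def sorted_wrt_rev)
  then obtain x y zs where s_eq: "s = x # y # zs"
    by (cases s; cases "tl s") auto
  define ps where "ps = (if x = q then y # zs else s)"
  have ps: "ps \<noteq> []" "sorted_wrt (>) ps" "set ps \<subseteq> V - {a}" "last ps = last s"
    "hd ps \<noteq> q" "2 * k + 2 \<le> length ps"
    using s by (auto simp: ps_def s_eq)
  have "{a, hd ps} \<notin> R"
    using pm_edge_unique[OF Suc.prems(3) q(1), of "{a, hd ps}" a] ps(5) q
    by (auto simp: doubleton_eq_iff)
  moreover have "\<exists>P. descending_path N (V - {a, p}) R' P \<and> 2 ^ k * fact k \<le> length P \<and>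
      (\<forall>X. pm (V - {a, p}) X \<longrightarrow> cost N (last P) \<le> cost N X)"
    if "p \<in> V - {a}" "pm (V - {a, p}) R'" for p R'
    using that Suc.prems a fin by (intro Suc.IH) (auto simp: card_Diff_subset)
  ultimately obtain P where P: "descending_path N V R P" "length ps * (2 ^ k * fact k) \<le> length P"
    "\<And>X. pm (V - {a, last ps}) X \<Longrightarrow> cost N (last P) \<le> cost N (insert {a, last ps} X)"
    "{a, last ps} \<in> last P"
    using descending_path_blocks[OF Suc.prems(1) a, of "2 ^ k * fact k" ps R] ps Suc.prems by auto
  define p where "p = last ps"
  have p: "p \<in> V" "p \<noteq> a" "\<And>v. v \<in> V - {a} \<Longrightarrow> p \<le> v"
  proof -
    have "last s \<in> set s" "\<And>v. v \<in> set s \<Longrightarrow> last s \<le> v"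
      using last_le_if_sorted_wrt_greater[OF s(2)] by (auto simp: s_eq)
    then show "p \<in> V" "p \<noteq> a" "\<And>v. v \<in> V - {a} \<Longrightarrow> p \<le> v"
      unfolding p_def ps(4) s(1) by auto
  qed
  have pmlast: "pm V (last P)"
    using P by (auto simp: descending_path_def)
  \<comment> \<open>Either \<open>X\<close> uses the smallest partner of \<open>a\<close> too, and
    minimality within the last block applies, or its partner is larger and already makes
    \<open>X\<close> more expensive.\<close>
  have "cost N (last P) \<le> cost N X" if X: "pm V X" for X
  proof -
    obtain r where r: "{a, r} \<in> X" "r \<in> V" "r \<noteq> a"
      using pm_edgeE[OF X a(1)] by auto
    have rem: "pm (V - {a, r}) (X - {{a, r}})"
      by (rule pm_remove_edge) fact+
    show ?thesis
    proof (cases "r = p")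
      case True
      then show ?thesis
        using P(3)[of "X - {{a, r}}"] rem r by (simp add: p_def insert_absorb)
    next
      case False
      then have "p < r"
        using p(3)[of r] r by auto
      moreover have "pm (V - {a, p}) (last P - {{a, p}})"
        using P(4) pmlast by (intro pm_remove_edge) (auto simp: p_def)
      ultimately have "cost N (insert {a, p} (last P - {{a, p}})) < cost N (insert {a, r} (X - {{a, r}}))"
        using rem Suc.prems(1) a p r by (intro cost_less_of_partner[where V = V]) auto
      then show ?thesis
        using P(4) r by (simp add: p_def insert_absorb)
    qed
  qed
  moreover have "2 ^ Suc k * fact (Suc k) \<le> length P"
  proof -
    have "2 ^ Suc k * fact (Suc k) = (2 * k + 2) * (2 ^ k * fact k :: nat)"
      by (simp add: algebra_simps)
    also have "\<dots> \<le> length ps * (2 ^ k * fact k)"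
      using ps(6) by (rule mult_le_mono1)
    finally show ?thesis
      using P(2) by linarith
  qed
  ultimately show ?case
    using P(1) by blast
qed

section \<open>Faces and vertices of the fractional matching polytope\<close>

definition deg :: "nat \<Rightarrow> (nat set \<Rightarrow> real) \<Rightarrow> nat \<Rightarrow> real" where
  "deg n x v = (\<Sum>e\<in>{e \<in> complete_edges {..<n}. v \<in> e}. x e)"

lemma finite_complete_edges [simp]: "finite V \<Longrightarrow> finite (complete_edges V)"
  by (rule finite_subset[of _ "Pow V"]) (auto simp: complete_edges_def)

lemma deg_linear:
  "deg n (x + y) v = deg n x v + deg n y v" "deg n (r *\<^sub>R x) v = r * deg n x v"
  "deg n (x - y) v = deg n x v - deg n y v"
  by (auto simp: deg_def sum.distrib sum_distrib_left scaleR_fun_def sum_subtractf)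

lemma deg_support:
  assumes "A \<subseteq> complete_edges {..<n}" "\<And>e. e \<notin> A \<Longrightarrow> x e = 0"
  shows "deg n x v = (\<Sum>e\<in>{e \<in> A. v \<in> e}. x e)"
  unfolding deg_def by (rule sum.mono_neutral_right) (use assms in auto)

lemma mem_FM_K:
  "x \<in> FM_K n \<longleftrightarrow> (\<forall>e. e \<notin> complete_edges {..<n} \<longrightarrow> x e = 0) \<and> (\<forall>e. 0 \<le> x e) \<and> (\<forall>v<n. deg n x v \<le> 1)"
  by (auto simp: FM_K_def fractional_matching_polytope_def coordinate_space_def deg_def)

lemma mem_FPM_K: "x \<in> FPM_K n \<longleftrightarrow> x \<in> FM_K n \<and> (\<forall>v<n. deg n x v = 1)"
  by (auto simp: FM_K_def FPM_K_def fractional_matching_polytope_def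
      fractional_perfect_matching_polytope_def coordinate_space_def deg_def)

lemma edge_le_deg:
  assumes "x \<in> FM_K n" "v \<in> e"
  shows "x e \<le> deg n x v"
proof (cases "e \<in> complete_edges {..<n}")
  case True
  then show ?thesis
    unfolding deg_def using assms by (intro member_le_sum) (auto simp: mem_FM_K)
next
  case False
  then show ?thesis
    using assms by (auto simp: mem_FM_K deg_def intro!: sum_nonneg)
qed

lemma FM_K_le_1:
  assumes "x \<in> FM_K n"
  shows "x e \<le> 1"
proof (cases "e \<in> complete_edges {..<n}")
  case True
  then obtain v where "v \<in> e" "v < n"
    by (force simp: complete_edges_def card_2_iff)
  then show ?thesis
    using edge_le_deg[OF assms, of v e] assms by (force simp: mem_FM_K)
qed (use assms in \<open>auto simp: mem_FM_K\<close>)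

lemma convex_FM_K: "convex (FM_K n)"
proof (rule convexI)
  fix x y and s t :: real
  assume *: "x \<in> FM_K n" "y \<in> FM_K n" "0 \<le> s" "0 \<le> t" "s + t = 1"
  have "deg n (s *\<^sub>R x + t *\<^sub>R y) v \<le> 1" if "v < n" for v
    using convex_bound_le[of "deg n x v" 1 "deg n y v" s t] * that
    by (simp add: deg_linear mem_FM_K)
  then show "s *\<^sub>R x + t *\<^sub>R y \<in> FM_K n"
    using * by (auto simp: mem_FM_K scaleR_fun_def)
qed

definition FM_face :: "nat \<Rightarrow> nat set set \<Rightarrow> nat set \<Rightarrow> (nat set \<Rightarrow> real) set" where
  "FM_face n A W = {x \<in> FM_K n. (\<forall>e. e \<notin> A \<longrightarrow> x e = 0) \<and> (\<forall>v\<in>W. deg n x v = 1)}"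

lemma convex_combination_eq_upper_bound:
  fixes a b t :: real
  assumes "a \<le> c" "b \<le> c" "(1 - t) * a + t * b = c" "0 < t" "t < 1"
  shows "a = c \<and> b = c"
proof -
  have "(1 - t) * (c - a) + t * (c - b) = 0"
    using assms(3) by (simp add: algebra_simps)
  moreover have "(1 - t) * (c - a) \<ge> 0" "t * (c - b) \<ge> 0"
    using assms by auto
  ultimately have "(1 - t) * (c - a) = 0" "t * (c - b) = 0"
    by linarith+
  then show ?thesis
    using assms by auto
qed

text \<open>A valid inequality that is tight at an inner point of a segment of the polytope is tight
  at both ends.\<close>

lemma FM_face_face_of:
  assumes "W \<subseteq> {..<n}"
  shows "FM_face n A W face_of FM_K n"
  unfolding face_of_def
proof (intro conjI ballI impI)
  show "FM_face n A W \<subseteq> FM_K n"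
    by (auto simp: FM_face_def)
  show "convex (FM_face n A W)"
  proof (rule convexI)
    fix x y and s t :: real
    assume "x \<in> FM_face n A W" "y \<in> FM_face n A W" "0 \<le> s" "0 \<le> t" "s + t = 1"
    then show "s *\<^sub>R x + t *\<^sub>R y \<in> FM_face n A W"
      using convexD[OF convex_FM_K, of x n y s t]
      by (auto simp: FM_face_def deg_linear) (simp add: scaleR_fun_def)
  qed
  fix a b x
  assume ab: "a \<in> FM_K n" "b \<in> FM_K n" and x: "x \<in> FM_face n A W" "x \<in> open_segment a b"
  then obtain t where t: "0 < t" "t < 1" "x = (1 - t) *\<^sub>R a + t *\<^sub>R b"
    by (auto simp: in_segment)
  have "a e = 0 \<and> b e = 0" if "e \<notin> A" for e
  proof -
    have "- a e \<le> 0" "- b e \<le> 0" "(1 - t) * - a e + t * - b e = 0"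
      using ab x(1) t(3) that by (auto simp: mem_FM_K FM_face_def scaleR_fun_def)
    from convex_combination_eq_upper_bound[OF this t(1,2)] show ?thesis
      by simp
  qed
  moreover have "deg n a v = 1 \<and> deg n b v = 1" if "v \<in> W" for v
  proof -
    have "deg n a v \<le> 1" "deg n b v \<le> 1" "(1 - t) * deg n a v + t * deg n b v = 1"
      using ab x(1) t(3) that assms by (auto simp: mem_FM_K FM_face_def deg_linear)
    from convex_combination_eq_upper_bound[OF this t(1,2)] show ?thesis .
  qed
  ultimately show "a \<in> FM_face n A W" "b \<in> FM_face n A W"
    using ab by (auto simp: FM_face_def)
qed

text \<open>An extreme point is determined by its tight constraints. If a different \<open>y\<close>
  satisfied them all with equality, one could move from \<open>x\<close> a little further away from
  \<open>y\<close> without leaving the polytope, which puts \<open>x\<close> inside a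
  segment.\<close>

lemma extreme_point_FM_K_unique:
  assumes x: "x extreme_point_of FM_K n" and y: "y \<in> FM_K n"
    and supp: "\<And>e. x e = 0 \<Longrightarrow> y e = 0" and tight: "\<And>v. v < n \<Longrightarrow> deg n x v = 1 \<Longrightarrow> deg n y v = 1"
  shows "x = y"
proof (rule ccontr)
  assume "x \<noteq> y"
  define z where "z t = x + t *\<^sub>R (x - y)" for t :: real
  have xF: "x \<in> FM_K n"
    using x by (simp add: extreme_point_of_def)
  have "eventually (\<lambda>t. 0 \<le> z t e) (at_right 0)" for e
  proof (cases "x e = 0")
    case False
    have "((\<lambda>t. x e + t * (x e - y e)) \<longlongrightarrow> x e) (at_right 0)"
      by (auto intro!: tendsto_eq_intros)
    moreover have "x e > 0"
      using False xF by (auto simp: mem_FM_K less_le)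
    ultimately show ?thesis
      by (auto simp: z_def scaleR_fun_def dest!: order_tendstoD(1) elim: eventually_mono)
  qed (simp add: z_def scaleR_fun_def supp)
  then have "eventually (\<lambda>t. \<forall>e\<in>complete_edges {..<n}. 0 \<le> z t e) (at_right 0)"
    by (intro eventually_ball_finite) auto
  moreover have "eventually (\<lambda>t. deg n (z t) v \<le> 1) (at_right 0)" if "v < n" for v
  proof (cases "deg n x v = 1")
    case False
    have "((\<lambda>t. deg n x v + t * (deg n x v - deg n y v)) \<longlongrightarrow> deg n x v) (at_right 0)"
      by (auto intro!: tendsto_eq_intros)
    moreover have "deg n x v < 1"
      using False xF that by (auto simp: mem_FM_K less_le)
    ultimately show ?thesis
      by (auto simp: z_def deg_linear dest!: order_tendstoD(2) elim: eventually_mono)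
  qed (use that tight in \<open>simp add: z_def deg_linear\<close>)
  then have "eventually (\<lambda>t. \<forall>v\<in>{..<n}. deg n (z t) v \<le> 1) (at_right 0)"
    by (intro eventually_ball_finite) auto
  moreover have "eventually (\<lambda>t. t > 0) (at_right (0::real))"
    by (rule eventually_at_right_less)
  ultimately have "eventually (\<lambda>t. (\<forall>e\<in>complete_edges {..<n}. 0 \<le> z t e) \<and>
      (\<forall>v\<in>{..<n}. deg n (z t) v \<le> 1) \<and> t > 0) (at_right 0)"
    by (intro eventually_conj)
  then obtain t where t: "\<forall>e\<in>complete_edges {..<n}. 0 \<le> z t e" "\<forall>v\<in>{..<n}. deg n (z t) v \<le> 1" "t > 0"
    using eventually_happens'[OF trivial_limit_at_right_real] by blast
  have zero: "z t e = 0" if "e \<notin> complete_edges {..<n}" for e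
    using that xF y by (simp add: z_def mem_FM_K scaleR_fun_def)
  have "z t \<in> FM_K n"
    unfolding mem_FM_K using t zero by (metis lessThan_iff order.refl)
  \<comment> \<open>These weights come from solving \<open>z t = x + t *\<^sub>R (x - y)\<close> for
    \<open>x\<close>.\<close>
  moreover have "x = (1 - 1 / (1 + t)) *\<^sub>R y + (1 / (1 + t)) *\<^sub>R z t"
  proof
    fix e
    have "1 - 1 / (1 + t) = t / (1 + t)"
      using t(3) by (simp add: field_simps)
    then have "((1 - 1 / (1 + t)) *\<^sub>R y + (1 / (1 + t)) *\<^sub>R z t) e = (t * y e + z t e) / (1 + t)"
      by (simp add: scaleR_fun_def add_divide_distrib)
    also have "t * y e + z t e = x e * (1 + t)"
      by (simp add: z_def scaleR_fun_def algebra_simps)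
    finally show "x e = ((1 - 1 / (1 + t)) *\<^sub>R y + (1 / (1 + t)) *\<^sub>R z t) e"
      using t(3) by simp
  qed
  then have "x \<in> open_segment y (z t)"
    unfolding in_segment
  proof (intro conjI exI)
    show "y \<noteq> z t"
    proof
      assume "y = z t"
      then have "(1 + t) *\<^sub>R (x - y) = 0"
        by (simp add: z_def algebra_simps)
      then show False
        using t(3) \<open>x \<noteq> y\<close> by simp
    qed
  qed (use t(3) in auto)
  ultimately show False
    using x y by (auto simp: extreme_point_of_def)
qed

section \<open>Finiteness of the vertex sets and inclusions between the polytopes\<close>

lemma finite_vertices_FM_K: "finite (vertices (FM_K n))"
proof -
  \<comment> \<open>A vertex is encoded by its tight constraints, for which there are only finitely
    many possibilities.\<close>
  let ?f = "\<lambda>x. ({e \<in> complete_edges {..<n}. x e = 0}, {v \<in> {..<n}. deg n x v = 1})"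
  have "inj_on ?f (vertices (FM_K n))"
  proof (rule inj_onI)
    fix x y assume xy: "x \<in> vertices (FM_K n)" "y \<in> vertices (FM_K n)" "?f x = ?f y"
    then have ext: "x extreme_point_of FM_K n" "y \<in> FM_K n"
      by (auto simp: vertices_def extreme_point_of_def)
    show "x = y"
    proof (rule extreme_point_FM_K_unique[OF ext])
      show "y e = 0" if "x e = 0" for e
        using that xy(3) ext(2) by (cases "e \<in> complete_edges {..<n}") (auto simp: mem_FM_K)
      show "deg n y v = 1" if "v < n" "deg n x v = 1" for v
        using that xy(3) by auto
    qed
  qed
  moreover have "finite (?f ` vertices (FM_K n))"
    by (rule finite_subset[of _ "Pow (complete_edges {..<n}) \<times> Pow {..<n}"]) auto
  ultimately show ?thesis
    by (rule finite_imageD[rotated])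
qed

lemma FPM_K_face_of: "FPM_K n face_of FM_K n"
proof -
  have "FPM_K n = FM_face n UNIV {..<n}"
    by (auto simp: mem_FPM_K FM_face_def)
  then show ?thesis
    using FM_face_face_of by simp
qed

lemma finite_vertices_FPM_K: "finite (vertices (FPM_K n))"
  by (rule finite_subset[OF _ finite_vertices_FM_K[of n]])
    (auto simp: vertices_def extreme_point_of_face[OF FPM_K_face_of])

lemma finite_matchings: "finite {indicator M :: nat set \<Rightarrow> real | M. M \<subseteq> complete_edges {..<n} \<and> P M}"
  by (rule finite_subset[of _ "indicator ` Pow (complete_edges {..<n})"]) auto

lemma finite_vertices_M_K: "finite (vertices (M_K n))"
  by (rule finite_subset[OF _ finite_matchings])
    (auto simp: vertices_def M_K_def matching_polytope_def matching_def
      dest!: extreme_point_of_convex_hull)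

lemma finite_vertices_PM_K: "finite (vertices (PM_K n))"
  by (rule finite_subset[OF _ finite_matchings])
    (auto simp: vertices_def PM_K_def perfect_matching_polytope_def perfect_matching_def
      dest!: extreme_point_of_convex_hull)

lemma indicator_matching_in_FM_K:
  assumes "matching {..<n} (complete_edges {..<n}) M"
  shows "indicator M \<in> FM_K n"
proof -
  have M: "M \<subseteq> complete_edges {..<n}"
    using assms by (simp add: matching_def)
  then have finM: "finite M"
    by (rule finite_subset) simp
  have "deg n (indicator M) v \<le> 1" if "v < n" for v
  proof -
    have "deg n (indicator M) v = real (card {e \<in> M. v \<in> e})"
      using M by (subst deg_support[OF M]) auto
    moreover have "card {e \<in> M. v \<in> e} \<le> 1"
      using assms that by (intro card_le_Suc0_iff_eq[THEN iffD2, unfolded One_nat_def[symmetric]])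
        (auto simp: matching_def finM)
    ultimately show ?thesis
      by simp
  qed
  then show ?thesis
    using M by (auto simp: mem_FM_K indicator_def)
qed

lemma M_K_subset: "M_K n \<subseteq> FM_K n"
  unfolding M_K_def matching_polytope_def
  by (rule hull_minimal) (auto intro: indicator_matching_in_FM_K convex_FM_K)

text \<open>Faces lying in a smaller convex set are faces of it. Adjacency thus has to be shown only
  once, in the largest polytope.\<close>

lemma adjacent_subset:
  assumes "adjacent Q u v" "R \<subseteq> Q" "convex R" "u \<in> R" "v \<in> R"
  shows "adjacent R u v"
  using assms face_of_subset[of "closed_segment u v" Q R] closed_segment_subset[of u R v]
  unfolding adjacent_def vertices_def extreme_point_of_def mem_Collect_eq by blast

text \<open>Linear programming duality with strict complementary slackness: \<open>Y\<close> is the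
  dual solution. Up to a constant, \<open>f\<close> is a nonnegative combination of edge values and
  degree slacks that vanishes exactly on the face.\<close>

lemma FM_K_unique_min:
  fixes \<omega> :: "nat set \<Rightarrow> real" and Y :: "nat \<Rightarrow> real" and L :: real
    and n :: nat and W :: "nat set"
  defines "f \<equiv> \<lambda>x. (\<Sum>e\<in>complete_edges {..<n}. \<omega> e * x e) - L * (\<Sum>v\<in>W. deg n x v)"
  assumes slack: "\<And>e. e \<in> complete_edges {..<n} \<Longrightarrow> e \<notin> A \<Longrightarrow> (\<Sum>v\<in>e. Y v) < \<omega> e"
    and tight: "\<And>e. e \<in> complete_edges {..<n} \<Longrightarrow> e \<in> A \<Longrightarrow> (\<Sum>v\<in>e. Y v) = \<omega> e"
    and W: "W \<subseteq> {..<n}" and Y: "\<And>v. v \<in> W \<Longrightarrow> Y v < L" "\<And>v. v < n \<Longrightarrow> v \<notin> W \<Longrightarrow> Y v = 0"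
    and z: "z \<in> FM_face n A W" and x: "x \<in> FM_K n" "x \<notin> FM_face n A W"
  shows "f z < f x"
proof -
  let ?E = "complete_edges {..<n}"
  define s where "s e = \<omega> e - (\<Sum>v\<in>e. Y v)" for e
  have finW: "finite W"
    using W finite_subset by blast
  \<comment> \<open>Exchanging the order of summation collects the potentials of both ends at each
    edge, which leaves the reduced costs \<open>s\<close>.\<close>
  have f_eq: "f y = (\<Sum>e\<in>?E. s e * y e) + (\<Sum>v\<in>W. (L - Y v) * (1 - deg n y v)) - (\<Sum>v\<in>W. L - Y v)" for y
  proof -
    have "(\<Sum>v\<in>W. Y v * deg n y v) = (\<Sum>v\<in>{..<n}. Y v * deg n y v)"
      using W Y(2) by (intro sum.mono_neutral_left) auto
    also have "\<dots> = (\<Sum>v\<in>{..<n}. \<Sum>e\<in>{e \<in> ?E. v \<in> e}. Y v * y e)"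
      by (simp add: deg_def sum_distrib_left)
    also have "\<dots> = (\<Sum>e\<in>?E. \<Sum>v\<in>{v \<in> {..<n}. v \<in> e}. Y v * y e)"
      by (rule sum.swap_restrict) auto
    also have "\<dots> = (\<Sum>e\<in>?E. (\<Sum>v\<in>e. Y v) * y e)"
    proof (rule sum.cong)
      fix e assume "e \<in> ?E"
      then have "{v \<in> {..<n}. v \<in> e} = e"
        by (auto simp: complete_edges_def)
      then show "(\<Sum>v\<in>{v \<in> {..<n}. v \<in> e}. Y v * y e) = (\<Sum>v\<in>e. Y v) * y e"
        by (simp add: sum_distrib_right)
    qed simp
    finally have "(\<Sum>v\<in>W. Y v * deg n y v) = (\<Sum>e\<in>?E. (\<Sum>v\<in>e. Y v) * y e)" .
    then show ?thesis
      by (simp add: f_def s_def algebra_simps sum.distrib sum_subtractf sum_distrib_left)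
  qed
  have "(\<Sum>e\<in>?E. s e * z e) = 0"
  proof (intro sum.neutral ballI)
    show "s e * z e = 0" if "e \<in> ?E" for e
      using that z tight[of e] by (cases "e \<in> A") (auto simp: FM_face_def s_def)
  qed
  moreover have "(\<Sum>v\<in>W. (L - Y v) * (1 - deg n z v)) = 0"
    using z by (intro sum.neutral) (auto simp: FM_face_def)
  moreover have s0: "0 \<le> s e * x e" if "e \<in> ?E" for e
    using that slack[of e] tight[of e] x(1) by (cases "e \<in> A") (auto simp: s_def mem_FM_K)
  have w0: "0 \<le> (L - Y v) * (1 - deg n x v)" if "v \<in> W" for v
    using Y(1)[OF that] that W x(1) by (auto simp: mem_FM_K subset_iff)
  \<comment> \<open>A point outside the face has a positive value on some edge off \<open>A\<close>
    or a deficient degree on \<open>W\<close>; both are penalized with a positive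
    coefficient.\<close>
  have "0 < (\<Sum>e\<in>?E. s e * x e) + (\<Sum>v\<in>W. (L - Y v) * (1 - deg n x v))"
  proof (cases "\<exists>e. e \<notin> A \<and> x e \<noteq> 0")
    case True
    then obtain e where e: "e \<notin> A" "x e \<noteq> 0"
      by blast
    then have "e \<in> ?E" "x e > 0"
      using x(1) by (auto simp: mem_FM_K less_le)
    then have "0 < (\<Sum>e\<in>?E. s e * x e)"
      using s0 slack[of e] e by (intro sum_pos2[of _ e]) (auto simp: s_def)
    then show ?thesis
      using w0 by (intro add_pos_nonneg sum_nonneg) auto
  next
    case False
    then obtain v where v: "v \<in> W" "deg n x v \<noteq> 1"
      using x by (auto simp: FM_face_def)
    then have "deg n x v < 1"
      using x(1) W by (auto simp: mem_FM_K less_le)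
    then have "0 < (\<Sum>v\<in>W. (L - Y v) * (1 - deg n x v))"
      using w0 Y(1) v finW by (intro sum_pos2[of _ v]) auto
    then show ?thesis
      using s0 by (intro add_nonneg_pos sum_nonneg) auto
  qed
  ultimately show ?thesis
    unfolding f_eq by simp
qed

text \<open>
  The graph \<open>T\<close> on the vertices from \<open>2 * k\<close> on is empty or a triangle; it carries the
  part of a point that is common to the whole path.
\<close>

locale pm_tail =
  fixes n k :: nat and T :: "nat set set"
  assumes k: "2 * k \<le> n" "k > 0"
    and T: "T \<subseteq> complete_edges {2 * k..<n}"
    and T_deg: "\<And>v. v \<in> \<Union>T \<Longrightarrow> card {e \<in> T. v \<in> e} = 2"
    and T_rigid: "\<And>x :: nat set \<Rightarrow> real.
      \<forall>v \<in> \<Union>T. (\<Sum>e\<in>{e \<in> T. v \<in> e}. x e) = 1 \<Longrightarrow> \<forall>e \<in> T. x e = 1 / 2"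
begin

text \<open>Each vertex of \<open>T\<close> lies on two edges of \<open>T\<close>, so the value 1/2
  there gives degree one.\<close>

definition point :: "nat set set \<Rightarrow> nat set \<Rightarrow> real" where
  "point M e = indicator M e + indicator T e / 2"

text \<open>These are the vertices saturated by every point of the path; the other vertices of the
  graph have degree zero in all of them.\<close>

definition W :: "nat set" where
  "W = {..<2 * k} \<union> \<Union>T"

section \<open>Degrees of the path points and the faces spanned by them\<close>

lemma T_ge: "e \<in> T \<Longrightarrow> v \<in> e \<Longrightarrow> 2 * k \<le> v"
  and T_less: "e \<in> T \<Longrightarrow> v \<in> e \<Longrightarrow> v < n"
proof -
  have "v \<in> {2 * k..<n}" if "e \<in> T" "v \<in> e"
    using T that unfolding complete_edges_def by blast
  then show "e \<in> T \<Longrightarrow> v \<in> e \<Longrightarrow> 2 * k \<le> v" "e \<in> T \<Longrightarrow> v \<in> e \<Longrightarrow> v < n"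
    by simp_all
qed

lemma W_subset: "W \<subseteq> {..<n}"
  using k T_less by (auto simp: W_def)

lemma T_nonempty_edge: "e \<in> T \<Longrightarrow> e \<noteq> {}"
  using T by (auto simp: complete_edges_def)

lemma T_subset: "T \<subseteq> complete_edges {..<n}"
proof -
  have "complete_edges {2 * k..<n} \<subseteq> complete_edges {..<n}"
    by (auto simp: complete_edges_def)
  with T show ?thesis
    by (rule order_trans)
qed

lemma pm_subset: "pm {..<2 * k} M \<Longrightarrow> M \<subseteq> complete_edges {..<2 * k}"
  by (simp add: perfect_matching_def)

lemma inner_subset: "complete_edges {..<2 * k} \<subseteq> complete_edges {..<n}"
  using k by (auto simp: complete_edges_def)

lemma inner_T_disjoint: "e \<in> complete_edges {..<2 * k} \<Longrightarrow> e \<notin> T"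
proof
  assume e: "e \<in> complete_edges {..<2 * k}" "e \<in> T"
  then obtain v where "v \<in> e"
    using T_nonempty_edge by blast
  then show False
    using e T_ge[of e v] by (auto simp: complete_edges_def)
qed

lemma deg_inner:
  assumes "A \<subseteq> complete_edges {..<2 * k}" "\<And>e. e \<notin> A \<union> T \<Longrightarrow> x e = 0" "v < 2 * k"
  shows "deg n x v = (\<Sum>e\<in>{e \<in> A. v \<in> e}. x e)"
proof -
  have "{e \<in> A \<union> T. v \<in> e} = {e \<in> A. v \<in> e}"
    using T_ge[of _ v] assms(3) by fastforce
  then show ?thesis
    using deg_support[of "A \<union> T" n x v] assms(1,2) T_subset inner_subset by auto
qed

lemma deg_outer:
  assumes "A \<subseteq> complete_edges {..<2 * k}" "\<And>e. e \<notin> A \<union> T \<Longrightarrow> x e = 0" "2 * k \<le> v"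
  shows "deg n x v = (\<Sum>e\<in>{e \<in> T. v \<in> e}. x e)"
proof -
  have "{e \<in> A \<union> T. v \<in> e} = {e \<in> T. v \<in> e}"
    using assms(1,3) by (fastforce simp: complete_edges_def)
  then show ?thesis
    using deg_support[of "A \<union> T" n x v] assms(1,2) T_subset inner_subset by auto
qed

lemma point_support: "e \<notin> M \<union> T \<Longrightarrow> point M e = 0"
  by (simp add: point_def)

lemma pm_star:
  assumes "pm {..<2 * k} M" "e \<in> M" "v \<in> e"
  shows "{e \<in> M. v \<in> e} = {e}"
  using assms(2,3) pm_edge_unique[OF assms(1) _ assms(2) _ assms(3)] by blast

lemma deg_point:
  assumes "pm {..<2 * k} M"
  shows "deg n (point M) v = (if v \<in> W then 1 else 0)"
proof (cases "v < 2 * k")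
  case True
  then obtain e where e: "e \<in> M" "v \<in> e"
    using assms unfolding perfect_matching_def by blast
  have "e \<notin> T"
    using e(1) pm_subset[OF assms] inner_T_disjoint by blast
  then show ?thesis
    using deg_inner[OF pm_subset[OF assms], of "point M" v] point_support[of _ M] True e pm_star[OF assms e]
    by (simp add: W_def point_def)
next
  case False
  have "point M e = 1 / 2" if "e \<in> T" for e
    using that inner_T_disjoint[of e] pm_subset[OF assms] by (auto simp: point_def indicator_def)
  then have "(\<Sum>e\<in>{e \<in> T. v \<in> e}. point M e) = (\<Sum>e\<in>{e \<in> T. v \<in> e}. 1 / 2)"
    by (intro sum.cong) auto
  then have "deg n (point M) v = real (card {e \<in> T. v \<in> e}) / 2"
    using deg_outer[OF pm_subset[OF assms], of "point M" v] point_support[of _ M] False by simp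
  moreover have "card {e \<in> T. v \<in> e} = (if v \<in> \<Union>T then 2 else 0)"
  proof (cases "v \<in> \<Union>T")
    case False
    then have "{e \<in> T. v \<in> e} = {}"
      by blast
    then show ?thesis
      using False by (simp only: card.empty if_False)
  qed (simp add: T_deg)
  ultimately show ?thesis
    using False by (cases "v \<in> \<Union>T") (simp_all add: W_def)
qed

lemma point_in_FM_face:
  assumes "pm {..<2 * k} M" "M \<union> T \<subseteq> A"
  shows "point M \<in> FM_face n A W"
proof -
  have "point M e = 0" if "e \<notin> complete_edges {..<n}" for e
    using that point_support[of e M] T_subset pm_subset[OF assms(1)] inner_subset by blast
  moreover have "0 \<le> point M e" for e
    by (simp add: point_def)
  moreover have "point M e = 0" if "e \<notin> A" for e
    using that assms(2) by (intro point_support) auto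
  ultimately show ?thesis
    using deg_point[OF assms(1)] by (auto simp: FM_face_def mem_FM_K)
qed

lemma point_in_FM_K: "pm {..<2 * k} M \<Longrightarrow> point M \<in> FM_K n"
  using point_in_FM_face[of M UNIV] by (simp add: FM_face_def)

text \<open>The degree equations fix the values on \<open>T\<close> and make the values on
  \<open>M\<close> and \<open>M'\<close> at each inner vertex complementary. Linkage then leaves one
  free parameter \<open>t\<close>: the value is \<open>t\<close> on \<open>M - M'\<close>,
  \<open>1 - t\<close> on \<open>M' - M\<close> and 1 on common edges.\<close>

lemma FM_face_eq_segment:
  assumes M: "pm {..<2 * k} M" "pm {..<2 * k} M'" and "linked (\<Union>(M - M')) M M'"
  shows "FM_face n (M \<union> M' \<union> T) W = closed_segment (point M) (point M')"
proof
  show "closed_segment (point M) (point M') \<subseteq> FM_face n (M \<union> M' \<union> T) W"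
    using face_of_imp_convex[OF FM_face_face_of[OF W_subset]]
    by (rule closed_segment_subset[rotated 2]) (use M in \<open>auto intro: point_in_FM_face\<close>)
  show "FM_face n (M \<union> M' \<union> T) W \<subseteq> closed_segment (point M) (point M')"
  proof
    fix x assume x: "x \<in> FM_face n (M \<union> M' \<union> T) W"
    then have xF: "x \<in> FM_K n" and x0: "\<And>e. e \<notin> M \<union> M' \<union> T \<Longrightarrow> x e = 0"
      and x1: "\<And>v. v \<in> W \<Longrightarrow> deg n x v = 1"
      by (auto simp: FM_face_def)
    have sub: "M \<union> M' \<subseteq> complete_edges {..<2 * k}"
      using M pm_subset by blast
    have "\<forall>v\<in>\<Union>T. (\<Sum>e\<in>{e \<in> T. v \<in> e}. x e) = 1"
      using deg_outer[OF sub, of x] x0 x1 T_ge unfolding W_def by (metis UnI2 UnionE)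
    then have xT: "x e = 1 / 2" if "e \<in> T" for e
      using T_rigid that by blast
    have star: "(\<Sum>e\<in>{e \<in> M \<union> M'. v \<in> e}. x e) = 1" if "v < 2 * k" for v
      using deg_inner[OF sub, of x v] x0 x1[of v] that by (simp add: W_def)
    define \<alpha> where "\<alpha> v = (\<Sum>e\<in>{e \<in> M. v \<in> e}. x e)" for v
    have \<alpha>: "\<alpha> v = x e" if "e \<in> M" "v \<in> e" for e v
      unfolding \<alpha>_def pm_star[OF M(1) that] by simp
    \<comment> \<open>The degree equation at \<open>v\<close> relates an edge of \<open>M'\<close>
      to the edge of \<open>M\<close> there. Used at both ends of \<open>e\<close>, it shows that
      \<open>\<alpha>\<close> is constant also on edges of \<open>M'\<close>.\<close>
    have other: "\<exists>m\<in>M - M'. v \<in> m \<and> x e = 1 - x m" if "e \<in> M' - M" "v \<in> e" for e v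
    proof -
      have "v < 2 * k"
        using that pm_edge_subset[OF M(2)] by blast
      then obtain m where m: "m \<in> M" "v \<in> m"
        using M(1) unfolding perfect_matching_def by blast
      have "m \<notin> M'"
        using that m pm_edge_unique[OF M(2), of m e v] by auto
      moreover have "{e \<in> M \<union> M'. v \<in> e} = {m, e}"
        using pm_star[OF M(1) m] pm_star[OF M(2), of e v] that by auto
      moreover have "m \<noteq> e"
        using m that by auto
      ultimately show ?thesis
        using star[OF \<open>v < 2 * k\<close>] m by force
    qed
    have "\<forall>e\<in>M \<union> M'. \<forall>u\<in>e. \<forall>v\<in>e. \<alpha> u = \<alpha> v"
    proof (intro ballI)
      fix e u v assume e: "e \<in> M \<union> M'" "u \<in> e" "v \<in> e"
      show "\<alpha> u = \<alpha> v"
      proof (cases "e \<in> M")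
        case False
        then show ?thesis
          using other[of e u] other[of e v] e \<alpha> by fastforce
      qed (use e \<alpha> in auto)
    qed
    then have const: "\<forall>u\<in>\<Union>(M - M'). \<forall>v\<in>\<Union>(M - M'). \<alpha> u = \<alpha> v"
      using assms(3) unfolding linked_def by blast
    have bounds: "0 \<le> \<alpha> v \<and> \<alpha> v \<le> 1" if "v \<in> \<Union>(M - M')" for v
      using that \<alpha> xF FM_K_le_1[OF xF] by (auto simp: mem_FM_K)
    \<comment> \<open>If the matchings coincide, there is no edge to read \<open>t\<close> from, and
      any value in the unit interval serves.\<close>
    have "\<exists>t. 0 \<le> t \<and> t \<le> 1 \<and> (\<forall>v\<in>\<Union>(M - M'). \<alpha> v = t)"
    proof (cases "\<Union>(M - M') = {}")
      case True
      then show ?thesis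
        by (metis empty_iff zero_le_one order.refl)
    next
      case False
      then obtain u where u: "u \<in> \<Union>(M - M')"
        by blast
      then have "\<forall>v\<in>\<Union>(M - M'). \<alpha> v = \<alpha> u"
        using const by blast
      then show ?thesis
        using bounds[OF u] by blast
    qed
    then obtain t where t: "0 \<le> t" "t \<le> 1" "\<And>v. v \<in> \<Union>(M - M') \<Longrightarrow> \<alpha> v = t"
      by blast
    have ne: "\<exists>v. v \<in> e" if "e \<in> M \<union> M'" for e
    proof -
      have "card e = 2"
        using that pm_edge_card M by blast
      then show ?thesis
        by (metis card.empty ex_in_conv zero_neq_numeral)
    qed
    have xM: "x e = t" if e: "e \<in> M" "e \<notin> M'" for e
    proof -
      obtain v where "v \<in> e"
        using ne e by blast
      then have "\<alpha> v = x e" "\<alpha> v = t"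
        using e \<alpha> t(3) by blast+
      then show ?thesis
        by simp
    qed
    have xM': "x e = 1 - t" if e: "e \<in> M'" "e \<notin> M" for e
    proof -
      obtain v where "v \<in> e"
        using ne e by blast
      then obtain m where "m \<in> M" "m \<notin> M'" "x e = 1 - x m"
        using other e by blast
      then show ?thesis
        using xM by simp
    qed
    have xMM': "x e = 1" if e: "e \<in> M" "e \<in> M'" for e
    proof -
      obtain v where v: "v \<in> e"
        using ne e by blast
      then have "v < 2 * k"
        using e pm_edge_subset[OF M(2)] by blast
      have "{e \<in> M \<union> M'. v \<in> e} = {e}"
        using pm_star[OF M(1) e(1) v] pm_star[OF M(2) e(2) v] by auto
      then have "(\<Sum>e\<in>{e}. x e) = 1"
        using star[OF \<open>v < 2 * k\<close>] by (simp only:)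
      then show ?thesis
        by simp
    qed
    \<comment> \<open>\<open>t\<close> is the coefficient of \<open>point M\<close>, so the
      parameter of the segment, counted from \<open>point M\<close>, is
      \<open>1 - t\<close>.\<close>
    have "x = (1 - (1 - t)) *\<^sub>R point M + (1 - t) *\<^sub>R point M'"
    proof
      fix e
      have "e \<notin> M" "e \<notin> M'" if "e \<in> T"
        using that inner_T_disjoint[of e] sub by auto
      then show "x e = ((1 - (1 - t)) *\<^sub>R point M + (1 - t) *\<^sub>R point M') e"
        using xM[of e] xM'[of e] xMM'[of e] xT[of e] x0[of e]
        by (cases "e \<in> M"; cases "e \<in> M'"; cases "e \<in> T")
          (simp_all add: scaleR_fun_def point_def diff_divide_distrib)
    qed
    then show "x \<in> closed_segment (point M) (point M')"
      unfolding in_segment using t by (intro exI[of _ "1 - t"]) auto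
  qed
qed

text \<open>This is the degenerate case \<open>M = M'\<close> of the segment: the face shrinks to a
  single point.\<close>

lemma point_vertex:
  assumes "pm {..<2 * k} M"
  shows "point M \<in> vertices (FM_K n)" and "FM_face n (M \<union> T) W = {point M}"
proof -
  have "linked (\<Union>(M - M)) M M"
    by (simp add: linked_def)
  from FM_face_eq_segment[OF assms assms this] show *: "FM_face n (M \<union> T) W = {point M}"
    by simp
  show "point M \<in> vertices (FM_K n)"
    using FM_face_face_of[OF W_subset, of "M \<union> T"] unfolding *
    by (simp add: vertices_def face_of_singleton)
qed

lemma point_adjacent:
  assumes "pm {..<2 * k} M" "pm {..<2 * k} M'" "linked (\<Union>(M - M')) M M'" "point M \<noteq> point M'"
  shows "adjacent (FM_K n) (point M) (point M')"
  using assms(4) point_vertex(1)[OF assms(1)] point_vertex(1)[OF assms(2)]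
    FM_face_face_of[OF W_subset, of "M \<union> M' \<union> T"]
  unfolding FM_face_eq_segment[OF assms(1-3)] adjacent_def by blast

end

section \<open>An objective minimized at a perfect matching\<close>

context pm_tail
begin

text \<open>A value above every potential: the price of an edge foreign to the construction and the
  reward for degree on \<open>W\<close>.\<close>

definition big :: real where
  "big = 2 ^ (n * n + n + 1)"

definition edge_weight :: "nat set \<Rightarrow> real" where
  "edge_weight e =
     (if e \<in> complete_edges {..<2 * k} then weight n e else if e \<in> T then 0 else big)"

text \<open>A dual solution, tight exactly on the edges of the lexicographically smallest matching.\<close>

definition potential :: "nat \<Rightarrow> real" where
  "potential v = (if v < 2 * k \<and> even v then 2 ^ (n * (n - v) + v + 1) else 0)"

text \<open>The weights alone are nonnegative and would be minimized by the zero vector. The reward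
  term makes it profitable to saturate \<open>W\<close>; it is constant on the points of the path,
  which are therefore ordered by \<open>cost\<close>.\<close>

definition objective :: "(nat set \<Rightarrow> real) \<Rightarrow> real" where
  "objective x =
     (\<Sum>e\<in>complete_edges {..<n}. edge_weight e * x e) - big * (\<Sum>v\<in>W. deg n x v)"

definition optimal_pm :: "nat set set" where
  "optimal_pm = (\<lambda>i. {2 * i, 2 * i + 1}) ` {..<k}"

lemma pm_optimal_pm: "pm {..<2 * k} optimal_pm"
  unfolding perfect_matching_def
proof (intro conjI ballI)
  show "optimal_pm \<subseteq> complete_edges {..<2 * k}"
    by (auto simp: optimal_pm_def complete_edges_def)
  fix v assume v: "v \<in> {..<2 * k}"
  show "\<exists>!e. e \<in> optimal_pm \<and> v \<in> e"
  proof (rule ex1I[of _ "{2 * (v div 2), 2 * (v div 2) + 1}"])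
    have "v = 2 * (v div 2) \<or> v = 2 * (v div 2) + 1" "v div 2 < k"
      using v by auto
    then show "{2 * (v div 2), 2 * (v div 2) + 1} \<in> optimal_pm \<and>
        v \<in> {2 * (v div 2), 2 * (v div 2) + 1}"
      unfolding optimal_pm_def by blast
    fix e assume "e \<in> optimal_pm \<and> v \<in> e"
    then obtain i where "e = {2 * i, 2 * i + 1}" "v = 2 * i \<or> v = 2 * i + 1"
      by (auto simp: optimal_pm_def)
    then show "e = {2 * (v div 2), 2 * (v div 2) + 1}"
      by auto
  qed
qed

lemma linear_objective: "linear objective"
proof (intro linearI)
  fix x y :: "nat set \<Rightarrow> real" and r :: real
  show "objective (x + y) = objective x + objective y"
    by (simp add: objective_def deg_linear sum.distrib algebra_simps)
  have "(\<Sum>e\<in>complete_edges {..<n}. edge_weight e * (r *\<^sub>R x) e) =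
      r * (\<Sum>e\<in>complete_edges {..<n}. edge_weight e * x e)"
    by (simp add: scaleR_fun_def sum_distrib_left algebra_simps)
  then show "objective (r *\<^sub>R x) = r *\<^sub>R objective x"
    by (simp add: objective_def deg_linear flip: sum_distrib_left) (simp add: algebra_simps)
qed

lemma objective_point:
  assumes M: "pm {..<2 * k} M"
  shows "objective (point M) = cost n M - big * card W"
proof -
  have sub: "M \<subseteq> complete_edges {..<2 * k}"
    using pm_subset[OF M] .
  have "(\<Sum>e\<in>complete_edges {..<n}. edge_weight e * point M e) = (\<Sum>e\<in>M. edge_weight e * point M e)"
  proof (rule sum.mono_neutral_right)
    show "\<forall>e\<in>complete_edges {..<n} - M. edge_weight e * point M e = 0"
    proof
      fix e assume "e \<in> complete_edges {..<n} - M"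
      then show "edge_weight e * point M e = 0"
        using inner_T_disjoint[of e] by (auto simp: edge_weight_def point_def)
    qed
  qed (use sub inner_subset in auto)
  also have "\<dots> = cost n M"
    unfolding cost_def
  proof (rule sum.cong)
    fix e assume "e \<in> M"
    then show "edge_weight e * point M e = weight n e"
      using sub inner_T_disjoint[of e] by (auto simp: edge_weight_def point_def)
  qed simp
  finally show ?thesis
    by (simp add: objective_def deg_point[OF M])
qed

lemma potential_le: "potential v \<le> 2 ^ (n * (n - v) + v + 1)"
  by (simp add: potential_def)

lemma potential_less_big: "potential v < big"
proof (cases "v < 2 * k \<and> even v")
  case True
  then have "v < n"
    using k by simp
  have "n * (n - v) + v + 1 < n * n + n + 1"
    using mult_le_mono2[of "n - v" n n] \<open>v < n\<close> by linarith
  then show ?thesis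
    using True power_strict_increasing[of "n * (n - v) + v + 1" "n * n + n + 1" "2::real"]
    by (simp add: potential_def big_def)
qed (auto simp: potential_def big_def)

text \<open>The potential of an even \<open>i\<close> is the weight of \<open>{i, i + 1}\<close>. If
  \<open>i\<close> is even and \<open>j\<close> at least \<open>i + 2\<close>, both potentials are
  at most this weight, one of them strictly less, and its double is at most the weight of
  \<open>{i, j}\<close>. If \<open>i\<close> is odd, only \<open>j\<close> contributes, with a
  smaller exponent.\<close>

lemma potential_slack_inner:
  assumes "i < j" "j < 2 * k"
  shows "{i, j} \<in> optimal_pm \<Longrightarrow> potential i + potential j = weight n {i, j}"
    and "{i, j} \<notin> optimal_pm \<Longrightarrow> potential i + potential j < weight n {i, j}"
proof -
  have w: "weight n {i, j} = 2 ^ (n * (n - i) + j)"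
    using assms by (simp add: weight_def min_def max_def)
  have jn: "j < n"
    using assms k by simp
  show "potential i + potential j = weight n {i, j}" if ij: "{i, j} \<in> optimal_pm"
  proof -
    have "even i" "j = i + 1"
      using ij assms by (auto simp: optimal_pm_def doubleton_eq_iff)
    then show ?thesis
      unfolding w using assms by (simp add: potential_def)
  qed
  show "potential i + potential j < weight n {i, j}" if ij: "{i, j} \<notin> optimal_pm"
  proof -
    \<comment> \<open>Passing from \<open>j\<close> down to \<open>i\<close> gains
      \<open>n * d\<close> in the leading part of the exponent and, as \<open>n\<close> is at least
      2, this outweighs the change by \<open>d\<close> in the small part.\<close>
    define d where "d = j - i"
    have d: "0 < d" "j = i + d" "n - i = (n - j) + d"
      using assms jn by (auto simp: d_def)
    have mult: "n * (n - i) = n * (n - j) + n * d"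
      by (simp only: d(3) distrib_left)
    show ?thesis
    proof (cases "even i")
      case True
      have "j \<noteq> i + 1"
      proof
        assume "j = i + 1"
        then have "{i, j} = {2 * (i div 2), 2 * (i div 2) + 1}" "i div 2 < k"
          using True assms by auto
        then show False
          using ij unfolding optimal_pm_def by blast
      qed
      then have "i + 2 \<le> j"
        using assms by simp
      have "2 * d \<le> n * d"
        using jn assms by simp
      then have "n * (n - j) + j + 1 < n * (n - i) + i + 1"
        using mult d by linarith
      then have "potential j < 2 ^ (n * (n - i) + i + 1)"
        by (intro le_less_trans[OF potential_le] power_strict_increasing) simp_all
      then have "potential i + potential j < 2 ^ (n * (n - i) + i + 1) + 2 ^ (n * (n - i) + i + 1)"
        using potential_le[of i] by linarith
      also have "\<dots> = 2 ^ (n * (n - i) + (i + 2))"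
        by simp
      also have "\<dots> \<le> weight n {i, j}"
        unfolding w using \<open>i + 2 \<le> j\<close> by (intro power_increasing) auto
      finally show ?thesis .
    next
      case False
      have "2 * d \<le> n * d"
        using jn assms by simp
      then have "n * (n - j) + j + 1 < n * (n - i) + j"
        using mult d by linarith
      then have "potential j < weight n {i, j}"
        unfolding w by (intro le_less_trans[OF potential_le] power_strict_increasing) simp_all
      then show ?thesis
        using False by (simp add: potential_def)
    qed
  qed
qed

lemma edge_cases:
  assumes "e \<in> complete_edges {..<n}"
  obtains i j where "e = {i, j}" "i < j" "j < n"
proof -
  have "e \<subseteq> {..<n}" "card e = 2"
    using assms by (auto simp: complete_edges_def)
  then obtain x y where "e = {x, y}" "x \<noteq> y" "x < n" "y < n"
    by (auto simp: card_2_iff)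
  then show ?thesis
    using that[of x y] that[of y x] by (cases "x < y") (auto simp: insert_commute)
qed

text \<open>On \<open>T\<close> both potentials and the weight are zero. A foreign edge has an end
  of potential zero, and the other potential is below \<open>big\<close>.\<close>

lemma potential_slack:
  assumes e: "e \<in> complete_edges {..<n}"
  shows "e \<in> optimal_pm \<union> T \<Longrightarrow> (\<Sum>v\<in>e. potential v) = edge_weight e"
    and "e \<notin> optimal_pm \<union> T \<Longrightarrow> (\<Sum>v\<in>e. potential v) < edge_weight e"
proof -
  obtain i j where ij: "e = {i, j}" "i < j" "j < n"
    using edge_cases[OF e] .
  have sum: "(\<Sum>v\<in>e. potential v) = potential i + potential j"
    using ij by simp
  have inner: "e \<in> complete_edges {..<2 * k} \<longleftrightarrow> j < 2 * k"
    using ij by (auto simp: complete_edges_def)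
  have opt: "e \<in> optimal_pm \<Longrightarrow> j < 2 * k"
    using pm_subset[OF pm_optimal_pm] inner by blast
  have T_zero: "potential i + potential j = 0" if "e \<in> T"
    using T_ge[OF that, of i] T_ge[OF that, of j] ij by (simp add: potential_def)
  have T_inner: "\<not> j < 2 * k" if "e \<in> T"
    using T_ge[OF that, of j] ij by simp
  show "(\<Sum>v\<in>e. potential v) = edge_weight e" if "e \<in> optimal_pm \<union> T"
    using that
  proof
    assume "e \<in> optimal_pm"
    then show ?thesis
      unfolding sum edge_weight_def using inner opt potential_slack_inner(1)[of i j] ij by simp
  next
    assume "e \<in> T"
    then show ?thesis
      unfolding sum edge_weight_def using inner T_inner T_zero by simp
  qed
  show "(\<Sum>v\<in>e. potential v) < edge_weight e" if "e \<notin> optimal_pm \<union> T"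
  proof (cases "j < 2 * k")
    case True
    then show ?thesis
      unfolding sum edge_weight_def using inner potential_slack_inner(2)[of i j] ij that by simp
  next
    case False
    then have "potential j = 0"
      by (simp add: potential_def)
    then show ?thesis
      unfolding sum edge_weight_def using inner False that potential_less_big[of i] by simp
  qed
qed

text \<open>The face on which the dual solution is tight consists of \<open>point optimal_pm\<close>
  alone.\<close>

lemma objective_unique_min:
  assumes "x \<in> FM_K n" "x \<noteq> point optimal_pm"
  shows "objective (point optimal_pm) < objective x"
  unfolding objective_def
proof (rule FM_K_unique_min[where A = "optimal_pm \<union> T" and Y = potential])
  show "point optimal_pm \<in> FM_face n (optimal_pm \<union> T) W"
    by (rule point_in_FM_face[OF pm_optimal_pm order.refl])
  show "x \<notin> FM_face n (optimal_pm \<union> T) W"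
    using assms(2) point_vertex(2)[OF pm_optimal_pm] by simp
  show "potential v = 0" if "v < n" "v \<notin> W" for v
    using that by (simp add: W_def potential_def)
qed (use potential_slack potential_less_big W_subset assms in auto)

lemma height_ge_path:
  assumes Q: "Q \<subseteq> FM_K n" "convex Q" "finite (vertices Q)"
    and mem: "\<And>M. pm {..<2 * k} M \<Longrightarrow> point M \<in> Q"
  shows "2 ^ (k - 1) * fact (k - 1) - 1 \<le> height Q"
proof -
  have "{..<2 * k} \<subseteq> {..<n}" "card {..<2 * k} = 2 * Suc (k - 1)"
    using k by auto
  then obtain P where P: "descending_path n {..<2 * k} optimal_pm P"
    "2 ^ (k - 1) * fact (k - 1) \<le> length P"
    "\<And>X. pm {..<2 * k} X \<Longrightarrow> cost n (last P) \<le> cost n X"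
    using descending_path_exists[OF _ _ pm_optimal_pm] by blast
  have ne: "P \<noteq> []" and pmP: "\<And>M. M \<in> set P \<Longrightarrow> pm {..<2 * k} M"
    using P(1) by (auto simp: descending_path_def)
  have vert: "point M \<in> vertices Q" if "pm {..<2 * k} M" for M
    using point_vertex(1)[OF that] mem[OF that] Q(1)
    unfolding vertices_def extreme_point_of_def mem_Collect_eq by blast
  \<comment> \<open>The path ends at some matching of minimum cost. On matchings, cost and objective
    differ by a constant, so the unique minimum of the objective identifies it.\<close>
  have last: "point (last P) = point optimal_pm"
  proof (rule ccontr)
    assume "point (last P) \<noteq> point optimal_pm"
    then have "objective (point optimal_pm) < objective (point (last P))"
      using pmP ne by (intro objective_unique_min point_in_FM_K) auto
    then show False
      using P(3)[OF pm_optimal_pm] pmP[of "last P"] ne pm_optimal_pm by (simp add: objective_point)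
  qed
  have "length (map point P) - 1 \<le> height Q"
  proof (rule height_ge[OF Q(3) linear_objective])
    show "successively (\<lambda>u v. adjacent Q u v \<and> objective v < objective u) (map point P)"
      unfolding successively_map
    proof (rule successively_mono)
      show "successively (descends n) P"
        using P(1) by (simp add: descending_path_def)
      fix M M' assume M: "M \<in> set P" "M' \<in> set P" "descends n M M'"
      note pmM = pmP[OF M(1)] pmP[OF M(2)]
      have "objective (point M') < objective (point M)"
        using M(3) pmM by (simp add: objective_point)
      moreover from this have "point M \<noteq> point M'"
        by auto
      then have "adjacent (FM_K n) (point M) (point M')"
        using pmM M(3) by (intro point_adjacent) auto
      from adjacent_subset[OF this Q(1,2) mem[OF pmM(1)] mem[OF pmM(2)]]
      have "adjacent Q (point M) (point M')" .
      ultimately show "adjacent Q (point M) (point M') \<and> objective (point M') < objective (point M)"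
        by blast
    qed
    show "set (map point P) \<subseteq> vertices Q"
      using vert pmP by auto
    show "objective (last (map point P)) < objective v"
      if "v \<in> vertices Q" "v \<noteq> last (map point P)" for v
      using that ne last Q(1) objective_unique_min[of v]
      by (auto simp: last_map vertices_def extreme_point_of_def)
  qed (use ne in auto)
  then show ?thesis
    using P(2) by simp
qed

text \<open>This serves the smallest cases, where the bound from the long path is zero: a single
  edge into the optimum suffices.\<close>

lemma height_ge_1:
  assumes Q: "Q \<subseteq> FM_K n" "convex Q" "finite (vertices Q)"
    and z: "adjacent (FM_K n) z (point optimal_pm)" "z \<in> Q" "point optimal_pm \<in> Q"
  shows "1 \<le> height Q"
proof -
  have adj: "adjacent Q z (point optimal_pm)"
    using adjacent_subset[OF z(1) Q(1,2) z(2,3)] .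
  have "length [z, point optimal_pm] - 1 \<le> height Q"
  proof (rule height_ge[OF Q(3) linear_objective])
    show "successively (\<lambda>u v. adjacent Q u v \<and> objective v < objective u) [z, point optimal_pm]"
      using adj objective_unique_min[of z] z Q(1) by (auto simp: adjacent_def)
    show "set [z, point optimal_pm] \<subseteq> vertices Q"
      using adj by (auto simp: adjacent_def)
    show "objective (last [z, point optimal_pm]) < objective v"
      if "v \<in> vertices Q" "v \<noteq> last [z, point optimal_pm]" for v
      using that Q(1) objective_unique_min[of v] by (auto simp: vertices_def extreme_point_of_def)
  qed auto
  then show ?thesis
    by simp
qed

end

section \<open>The four polytopes of the complete graph\<close>

lemma pm_tail_empty:
  assumes "2 * k \<le> n" "k > 0"
  shows "pm_tail n k {}"
  using assms by unfold_locales auto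

definition triangle :: "nat \<Rightarrow> nat set set" where
  "triangle a = {{a, a + 1}, {a, a + 2}, {a + 1, a + 2}}"

lemma triangle_star:
  "{e \<in> triangle a. a \<in> e} = {{a, a + 1}, {a, a + 2}}"
  "{e \<in> triangle a. a + 1 \<in> e} = {{a, a + 1}, {a + 1, a + 2}}"
  "{e \<in> triangle a. a + 2 \<in> e} = {{a, a + 2}, {a + 1, a + 2}}"
  by (auto simp: triangle_def)

lemma Union_triangle: "\<Union>(triangle a) = {a, a + 1, a + 2}"
  by (auto simp: triangle_def)

text \<open>A triangle is an odd cycle, so the three equations for its edge values have the unique
  solution 1/2.\<close>

lemma pm_tail_triangle:
  assumes "k > 0"
  shows "pm_tail (2 * k + 3) k (triangle (2 * k))"
proof
  let ?a = "2 * k"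
  show "triangle ?a \<subseteq> complete_edges {?a..<2 * k + 3}"
    by (auto simp: triangle_def complete_edges_def)
  show "card {e \<in> triangle ?a. v \<in> e} = 2" if v: "v \<in> \<Union>(triangle ?a)" for v
  proof -
    consider "v = ?a" | "v = ?a + 1" | "v = ?a + 2"
      using v unfolding Union_triangle by blast
    then show ?thesis
      by cases (simp_all only: triangle_star, auto simp: doubleton_eq_iff)
  qed
  show "\<forall>e\<in>triangle ?a. x e = 1 / 2"
    if x: "\<forall>v\<in>\<Union>(triangle ?a). (\<Sum>e\<in>{e \<in> triangle ?a. v \<in> e}. x e) = 1"
    for x :: "nat set \<Rightarrow> real"
  proof -
    have "(\<Sum>e\<in>{e \<in> triangle ?a. ?a \<in> e}. x e) = 1"
      "(\<Sum>e\<in>{e \<in> triangle ?a. ?a + 1 \<in> e}. x e) = 1"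
      "(\<Sum>e\<in>{e \<in> triangle ?a. ?a + 2 \<in> e}. x e) = 1"
      using x unfolding Union_triangle by blast+
    then have "x {?a, ?a + 1} + x {?a, ?a + 2} = 1" "x {?a, ?a + 1} + x {?a + 1, ?a + 2} = 1"
      "x {?a, ?a + 2} + x {?a + 1, ?a + 2} = 1"
      unfolding triangle_star by (simp_all add: doubleton_eq_iff)
    then show ?thesis
      unfolding triangle_def by simp
  qed
qed (use assms in auto)

lemma indicator_in_M_K:
  assumes "pm {..<2 * k} M" "2 * k \<le> n"
  shows "indicator M \<in> M_K n"
proof -
  have "M \<subseteq> complete_edges {..<n}"
    using assms by (fastforce simp: perfect_matching_def complete_edges_def)
  then have "matching {..<n} (complete_edges {..<n}) M"
    using pm_edge_unique[OF assms(1)] unfolding matching_def by blast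
  then show ?thesis
    unfolding M_K_def matching_polytope_def by (intro hull_inc) blast
qed

lemma zero_in_M_K: "0 \<in> M_K n"
proof -
  have "indicator {} \<in> M_K n"
    unfolding M_K_def matching_polytope_def by (intro hull_inc) (auto simp: matching_def)
  moreover have "indicator {} = (0 :: nat set \<Rightarrow> real)"
    by (simp add: fun_eq_iff)
  ultimately show ?thesis
    by simp
qed

lemma convex_M_K: "convex (M_K n)" and convex_PM_K: "convex (PM_K n)"
  by (simp_all add: M_K_def PM_K_def matching_polytope_def perfect_matching_polytope_def)

lemma convex_FPM_K: "convex (FPM_K n)"
  using FPM_K_face_of face_of_imp_convex by blast

lemma FPM_K_subset: "FPM_K n \<subseteq> FM_K n"
  using FPM_K_face_of face_of_imp_subset by blast

lemma point_empty_tail: "pm_tail n k {} \<Longrightarrow> pm_tail.point {} M = indicator M"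
  by (simp add: fun_eq_iff pm_tail.point_def)

section \<open>Lower bounds on the heights of the individual polytopes\<close>

lemma height_M_K_ge:
  assumes "2 * k \<le> n" "k > 0" "M_K n \<subseteq> Q" "Q \<subseteq> FM_K n" "convex Q" "finite (vertices Q)"
  shows "2 ^ (k - 1) * fact (k - 1) - 1 \<le> height Q"
proof -
  interpret pm_tail n k "{}"
    using assms(1,2) by (rule pm_tail_empty)
  show ?thesis
  proof (rule height_ge_path[OF assms(4-6)])
    show "point M \<in> Q" if "pm {..<2 * k} M" for M
      using indicator_in_M_K[OF that assms(1)] assms(3) point_empty_tail[OF pm_tail_axioms] by auto
  qed
qed

text \<open>Dropping all coordinates except \<open>{0, 1}\<close> leaves the segment from the empty
  matching to a single edge.\<close>

lemma adjacent_zero_edge: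
  assumes "2 \<le> n"
  shows "adjacent (FM_K n) 0 (indicator {{0, 1}})"
proof -
  let ?u = "indicator {{0, 1}} :: nat set \<Rightarrow> real"
  have 0: "0 \<in> FM_K n"
    using zero_in_M_K M_K_subset by blast
  interpret pm_tail n 1 "{}"
    using assms by (intro pm_tail_empty) auto
  have "optimal_pm = {{0, 1}}"
    unfolding optimal_pm_def by auto
  then have u: "?u \<in> vertices (FM_K n)"
    using point_vertex(1)[OF pm_optimal_pm] unfolding point_empty_tail[OF pm_tail_axioms]
    by (simp only:)
  have "FM_face n {} {} = {0}"
    using 0 by (auto simp: FM_face_def fun_eq_iff)
  then have "0 \<in> vertices (FM_K n)"
    using FM_face_face_of[of "{}" n "{}"] by (simp add: vertices_def face_of_singleton)
  moreover have "FM_face n {{0, 1}} {} = closed_segment 0 ?u"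
  proof
    have "?u \<in> FM_K n"
      using u by (simp add: vertices_def extreme_point_of_def)
    then have "0 \<in> FM_face n {{0, 1}} {}" "?u \<in> FM_face n {{0, 1}} {}"
      using 0 by (auto simp: FM_face_def)
    then show "closed_segment 0 ?u \<subseteq> FM_face n {{0, 1}} {}"
      by (intro closed_segment_subset face_of_imp_convex[OF FM_face_face_of]) auto
    show "FM_face n {{0, 1}} {} \<subseteq> closed_segment 0 ?u"
    proof
      fix x assume x: "x \<in> FM_face n {{0, 1}} {}"
      then have "x = (1 - x {0, 1}) *\<^sub>R 0 + x {0, 1} *\<^sub>R ?u"
        by (auto simp: fun_eq_iff FM_face_def scaleR_fun_def indicator_def)
      moreover have "0 \<le> x {0, 1}" "x {0, 1} \<le> 1"
        using x FM_K_le_1[of x n] by (auto simp: FM_face_def mem_FM_K)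
      ultimately show "x \<in> closed_segment 0 ?u"
        unfolding in_segment by blast
    qed
  qed
  moreover have "0 \<noteq> ?u"
    by (metis indicator_simps(1) insertI1 zero_fun_apply zero_neq_one)
  ultimately show ?thesis
    using u FM_face_face_of[of "{}" n "{{0, 1}}"] by (simp add: adjacent_def)
qed

text \<open>For \<open>n\<close> equal to 2 or 3 the path of perfect matchings is a single vertex;
  the empty matching provides a predecessor.\<close>

lemma height_M_K_pos:
  assumes "2 \<le> n" "M_K n \<subseteq> Q" "Q \<subseteq> FM_K n" "convex Q" "finite (vertices Q)"
  shows "1 \<le> height Q"
proof -
  interpret pm_tail n 1 "{}"
    using assms by (intro pm_tail_empty) auto
  have "optimal_pm = {{0, 1}}"
    unfolding optimal_pm_def by auto
  then have u: "point optimal_pm = indicator {{0, 1}}"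
    unfolding point_empty_tail[OF pm_tail_axioms] by (simp only:)
  have "adjacent (FM_K n) 0 (point optimal_pm)"
    using adjacent_zero_edge[OF assms(1)] unfolding u .
  moreover have "point optimal_pm \<in> Q"
    using indicator_in_M_K[OF pm_optimal_pm, of n] assms point_empty_tail[OF pm_tail_axioms] by auto
  moreover have "0 \<in> Q"
    using zero_in_M_K assms(2) by blast
  ultimately show ?thesis
    using height_ge_1[OF assms(3-5)] by blast
qed

lemma height_PM_K_ge:
  assumes "k > 0" "PM_K (2 * k) \<subseteq> Q" "Q \<subseteq> FM_K (2 * k)" "convex Q" "finite (vertices Q)"
  shows "2 ^ (k - 1) * fact (k - 1) - 1 \<le> height Q"
proof -
  interpret pm_tail "2 * k" k "{}"
    using assms(1) by (intro pm_tail_empty) auto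
  show ?thesis
  proof (rule height_ge_path[OF assms(3-5)])
    fix M assume "pm {..<2 * k} M"
    then have "indicator M \<in> PM_K (2 * k)"
      unfolding PM_K_def perfect_matching_polytope_def by (intro hull_inc) blast
    then show "point M \<in> Q"
      using assms(2) point_empty_tail[OF pm_tail_axioms] by auto
  qed
qed

lemma PM_K_subset_FPM_K: "PM_K n \<subseteq> FPM_K n"
  unfolding PM_K_def perfect_matching_polytope_def
proof (rule hull_minimal)
  have "indicator M \<in> FPM_K n" if M: "pm {..<n} M" for M
  proof -
  have "deg n (indicator M) v = 1" if v: "v < n" for v
  proof -
    obtain e where e: "e \<in> M" "v \<in> e"
      using M v unfolding perfect_matching_def by blast
    then have "{e \<in> M. v \<in> e} = {e}"
      using pm_edge_unique[OF M _ e(1) _ e(2)] by blast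
    then show ?thesis
      using e M by (subst deg_support[of M]) (auto simp: perfect_matching_def)
  qed
  moreover have "indicator M \<in> FM_K n"
    using M pm_edge_unique[OF M]
    by (intro indicator_matching_in_FM_K) (unfold matching_def perfect_matching_def, blast)
  ultimately show ?thesis
    by (simp add: mem_FPM_K)
  qed
  then show "{indicator M | M. pm {..<n} M} \<subseteq> FPM_K n"
    by blast
qed (rule convex_FPM_K)

text \<open>With exactly three left-over vertices the triangle completes \<open>W\<close> to the
  full vertex set, so every degree is one.\<close>

lemma point_triangle_in_FPM_K:
  assumes "k > 0" "pm {..<2 * k} M"
  shows "pm_tail.point (triangle (2 * k)) M \<in> FPM_K (2 * k + 3)"
proof -
  interpret pm_tail "2 * k + 3" k "triangle (2 * k)"
    using assms(1) by (rule pm_tail_triangle)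
  have "{..<2 * k + 3} = W"
    unfolding W_def Union_triangle by auto
  then show ?thesis
    using point_in_FM_K[OF assms(2)] deg_point[OF assms(2)] by (auto simp: mem_FPM_K)
qed

lemma height_FPM_K_odd_ge:
  assumes "k > 0"
  shows "2 ^ (k - 1) * fact (k - 1) - 1 \<le> height (FPM_K (2 * k + 3))"
proof -
  interpret pm_tail "2 * k + 3" k "triangle (2 * k)"
    using assms by (rule pm_tail_triangle)
  show ?thesis
    using height_ge_path[OF FPM_K_subset convex_FPM_K finite_vertices_FPM_K]
      point_triangle_in_FPM_K[OF assms] by blast
qed

text \<open>
  Here the path from the induction is a single vertex. It is preceded by the vertex \<open>z\<close>: the
  supports of the two vertices form two triangles that share the vertex 2, and along the polytope edge the
  half-integral triangle moves from one to the other.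
\<close>

lemma height_FPM_K_5: "1 \<le> height (FPM_K 5)"
proof -
  interpret pm_tail 5 1 "triangle 2"
    using pm_tail_triangle[of 1] by simp
  \<comment> \<open>\<open>A\<close> is the union of the two triangles 0, 1, 2 and 2, 3, 4.\<close>
  define A :: "nat set set" where "A = {{0, 1}, {0, 2}, {1, 2}, {2, 3}, {2, 4}, {3, 4}}"
  define z :: "nat set \<Rightarrow> real" where
    "z e = indicator {{3, 4}} e + indicator {{0, 1}, {0, 2}, {1, 2}} e / 2" for e
  have opt: "optimal_pm = {{0, 1}}"
    unfolding optimal_pm_def by auto
  define u where "u = point optimal_pm"
  have u_eq: "u e = indicator {{0, 1}} e + indicator {{2, 3}, {2, 4}, {3, 4}} e / 2" for e
    unfolding u_def opt point_def by (simp add: triangle_def)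
  have A_sub: "A \<subseteq> complete_edges {..<5}"
    by (auto simp: A_def complete_edges_def)
  have stars: "{e \<in> A. 0 \<in> e} = {{0, 1}, {0, 2}}" "{e \<in> A. 1 \<in> e} = {{0, 1}, {1, 2}}"
    "{e \<in> A. 2 \<in> e} = {{0, 2}, {1, 2}, {2, 3}, {2, 4}}"
    "{e \<in> A. 3 \<in> e} = {{2, 3}, {3, 4}}" "{e \<in> A. 4 \<in> e} = {{2, 4}, {3, 4}}"
    by (auto simp: A_def)
  have degs: "deg 5 x 0 = x {0, 1} + x {0, 2}" "deg 5 x 1 = x {0, 1} + x {1, 2}"
    "deg 5 x 2 = x {0, 2} + x {1, 2} + x {2, 3} + x {2, 4}"
    "deg 5 x 3 = x {2, 3} + x {3, 4}" "deg 5 x 4 = x {2, 4} + x {3, 4}"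
    if x: "\<forall>e. e \<notin> A \<longrightarrow> x e = 0" for x :: "nat set \<Rightarrow> real"
  proof -
    have "deg 5 x v = (\<Sum>e\<in>{e \<in> A. v \<in> e}. x e)" for v
      by (rule deg_support[OF A_sub]) (use x in blast)
    from this[of 0] this[of 1] this[of 2] this[of 3] this[of 4]
    show "deg 5 x 0 = x {0, 1} + x {0, 2}" "deg 5 x 1 = x {0, 1} + x {1, 2}"
      "deg 5 x 2 = x {0, 2} + x {1, 2} + x {2, 3} + x {2, 4}"
      "deg 5 x 3 = x {2, 3} + x {3, 4}" "deg 5 x 4 = x {2, 4} + x {3, 4}"
      unfolding stars by (simp_all add: doubleton_eq_iff)
  qed
  have range5: "v < 5 \<longleftrightarrow> v = 0 \<or> v = 1 \<or> v = 2 \<or> v = 3 \<or> v = 4" for v :: nat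
    by linarith
  have z0: "\<forall>e. e \<notin> A \<longrightarrow> z e = 0"
    by (auto simp: z_def A_def)
  have z_vals: "z {0, 1} = 1 / 2" "z {0, 2} = 1 / 2" "z {1, 2} = 1 / 2"
    "z {2, 3} = 0" "z {2, 4} = 0" "z {3, 4} = 1"
    by (simp_all add: z_def doubleton_eq_iff)
  have z_deg: "deg 5 z v = 1" if "v < 5" for v
    using that degs[OF z0] unfolding range5 z_vals by auto
  have zF: "z \<in> FM_K 5"
    unfolding mem_FM_K using z0 A_sub z_deg by (auto simp: z_def)
  have u0: "\<forall>e. e \<notin> A \<longrightarrow> u e = 0"
    by (auto simp: u_eq A_def)
  have u_vals: "u {0, 1} = 1" "u {0, 2} = 0" "u {1, 2} = 0"
    "u {2, 3} = 1 / 2" "u {2, 4} = 1 / 2" "u {3, 4} = 1 / 2"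
    by (simp_all add: u_eq doubleton_eq_iff)
  have u_deg: "deg 5 u v = 1" if "v < 5" for v
    using that degs[OF u0] unfolding range5 u_vals by auto
  have uF: "u \<in> FM_K 5"
    unfolding u_def by (intro point_in_FM_K pm_optimal_pm)
  \<comment> \<open>The unknowns are the values on the edges of \<open>A\<close> in the listed
    order. The five degree equations leave one degree of freedom, \<open>d = x {2, 3}\<close>, and
    \<open>2 * d\<close> is the position between \<open>z\<close> and \<open>u\<close>.\<close>
  have solve: "a = (1 - 2 * d) / 2 + 2 * d" "b = (1 - 2 * d) / 2" "c = (1 - 2 * d) / 2"
    "d = 2 * d / 2" "e = 2 * d / 2" "f = (1 - 2 * d) + 2 * d / 2"
    if "a + b = 1" "a + c = 1" "b + c + d + e = 1" "d + f = 1" "e + f = 1" for a b c d e f :: real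
  proof -
    have "c = b" "f = 1 - d" "a = 1 - b"
      using that by linarith+
    moreover from this have "e = d" "b = 1 / 2 - d"
      using that by linarith+
    ultimately show "a = (1 - 2 * d) / 2 + 2 * d" "b = (1 - 2 * d) / 2" "c = (1 - 2 * d) / 2"
      "d = 2 * d / 2" "e = 2 * d / 2" "f = (1 - 2 * d) + 2 * d / 2"
      by (simp_all add: field_simps)
  qed
  have seg: "\<exists>t. 0 \<le> t \<and> t \<le> 1 \<and> t = 2 * x {2, 3} \<and> x = (1 - t) *\<^sub>R z + t *\<^sub>R u"
    if x: "x \<in> FM_face 5 A {..<5}" for x
  proof -
    have xF: "x \<in> FM_K 5" and x0: "\<forall>e. e \<notin> A \<longrightarrow> x e = 0"
      using x by (auto simp: FM_face_def)
    have "deg 5 x v = 1" if "v < 5" for v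
      using x that by (auto simp: FM_face_def)
    note deg1 = this[of 0] this[of 1] this[of 2] this[of 3] this[of 4]
    have eqs: "x {0, 1} + x {0, 2} = 1" "x {0, 1} + x {1, 2} = 1"
      "x {0, 2} + x {1, 2} + x {2, 3} + x {2, 4} = 1" "x {2, 3} + x {3, 4} = 1"
      "x {2, 4} + x {3, 4} = 1"
      using deg1 unfolding degs[OF x0] by simp_all
    define t where "t = 2 * x {2, 3}"
    have vals: "x {0, 1} = (1 - t) / 2 + t" "x {0, 2} = (1 - t) / 2" "x {1, 2} = (1 - t) / 2"
      "x {2, 3} = t / 2" "x {2, 4} = t / 2" "x {3, 4} = (1 - t) + t / 2"
      using solve[OF eqs] by (simp_all only: t_def)
    have "0 \<le> x {0, 2}" "0 \<le> x {2, 3}"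
      using xF by (auto simp: mem_FM_K)
    then have "0 \<le> t" "t \<le> 1"
      using vals by auto
    moreover have "x = (1 - t) *\<^sub>R z + t *\<^sub>R u"
    proof
      fix e
      show "x e = ((1 - t) *\<^sub>R z + t *\<^sub>R u) e"
      proof (cases "e \<in> A")
        case True
        then show ?thesis
          unfolding A_def insert_iff empty_iff
          by (elim disjE)
            (simp_all only: plus_fun_apply scaleR_fun_def real_scaleR_def vals z_vals u_vals, simp_all)
      qed (simp add: x0 z0 u0 scaleR_fun_def)
    qed
    ultimately show ?thesis
      unfolding t_def by blast
  qed
  have ends: "z \<in> FM_face 5 A {..<5}" "u \<in> FM_face 5 A {..<5}"
    using zF uF z0 u0 z_deg u_deg by (auto simp: FM_face_def)
  have "FM_face 5 A {..<5} = closed_segment z u"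
  proof
    show "FM_face 5 A {..<5} \<subseteq> closed_segment z u"
      unfolding subset_iff in_segment using seg by blast
    show "closed_segment z u \<subseteq> FM_face 5 A {..<5}"
      using ends face_of_imp_convex[OF FM_face_face_of] by (intro closed_segment_subset) auto
  qed
  then have "closed_segment z u face_of FM_K 5"
    using FM_face_face_of[of "{..<5}" 5 A] by simp
  \<comment> \<open>Forcing \<open>x {2, 3} = 0\<close> puts the segment parameter at zero, which
    exhibits \<open>z\<close> as a vertex.\<close>
  moreover have "FM_face 5 (A - {{2, 3}}) {..<5} = {z}"
  proof
    show "FM_face 5 (A - {{2, 3}}) {..<5} \<subseteq> {z}"
    proof
      fix x assume x: "x \<in> FM_face 5 (A - {{2, 3}}) {..<5}"
      then have "x \<in> FM_face 5 A {..<5}" "x {2, 3} = 0"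
        by (auto simp: FM_face_def)
      then show "x \<in> {z}"
        using seg[of x] by auto
    qed
    show "{z} \<subseteq> FM_face 5 (A - {{2, 3}}) {..<5}"
      using ends(1) z0 z_vals(4) by (auto simp: FM_face_def)
  qed
  then have "z \<in> vertices (FM_K 5)"
    using FM_face_face_of[of "{..<5}" 5 "A - {{2, 3}}"] by (simp add: vertices_def face_of_singleton)
  moreover have "u \<in> vertices (FM_K 5)"
    unfolding u_def by (intro point_vertex(1) pm_optimal_pm)
  moreover have "z \<noteq> u"
    using z_vals(4) u_vals(4) by auto
  ultimately have "adjacent (FM_K 5) z u"
    by (simp add: adjacent_def)
  moreover have "z \<in> FPM_K 5" "u \<in> FPM_K 5"
    using zF z_deg uF u_deg by (auto simp: mem_FPM_K)
  ultimately show ?thesis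
    using height_ge_1[OF FPM_K_subset convex_FPM_K finite_vertices_FPM_K] unfolding u_def by blast
qed

section \<open>Numerical estimates for the constant 1/3\<close>

lemma fact_bound:
  fixes h :: nat
  assumes "2 ^ m * fact m - 1 \<le> h" "1 \<le> h"
  shows "1 / 3 * fact m < real h"
\<comment> \<open>For \<open>m\<close> positive the factor \<open>2 ^ m\<close> is at least 2 and
  pays for the subtracted 1. For \<open>m = 0\<close> the positivity of \<open>h\<close> is what
  counts.\<close>
proof (cases "m = 0")
  case False
  then have "2 ^ 1 \<le> (2 ^ m :: nat)"
    by (intro power_increasing) auto
  then have "2 * fact m \<le> 2 ^ m * (fact m :: nat)"
    by (intro mult_le_mono1) simp
  moreover have "fact m \<ge> (1 :: nat)"
    by simp
  ultimately have "fact m \<le> h"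
    using assms(1) by linarith
  then have "fact m \<le> real h"
    by (metis of_nat_fact of_nat_le_iff)
  then show ?thesis
    using fact_gt_zero[of m, where ?'a = real] by linarith
qed (use assms in simp)

text \<open>The triangle uses up three vertices, so the path has a factorial one step too small. The
  power of two makes up for it, since \<open>k\<close> is at most \<open>2 ^ (k - 1)\<close>; the
  subtracted 1 costs at most half of \<open>fact k\<close> once \<open>k\<close> is at least
  2.\<close>

lemma fact_bound_odd:
  fixes h :: nat
  assumes "2 ^ (k - 1) * fact (k - 1) - 1 \<le> h" "1 \<le> h" "k > 0"
  shows "1 / 3 * fact k < real h"
proof (cases "k = 1")
  case False
  then obtain j where j: "k = Suc j" "j > 0"
    using assms(3) by (cases k) auto
  have "Suc j \<le> 2 ^ j"
    by (rule Suc_leI[OF less_exp])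
  then have "fact k \<le> 2 ^ j * (fact j :: nat)"
    unfolding j(1) fact_Suc by (simp del: mult_Suc)
  then have "fact k \<le> h + 1"
    using assms(1) j by simp
  then have "real (fact k) \<le> real (h + 1)"
    by (simp only: of_nat_le_iff)
  then have "fact k \<le> real h + 1"
    by simp
  moreover have "2 \<le> (fact k :: real)"
    using fact_mono[of 2 k, where ?'a = real] j by simp
  ultimately show ?thesis
    by linarith
qed (use assms in simp)

lemma nat_floor_half: "n \<ge> 2 \<Longrightarrow> nat \<lfloor>real n / 2 - 1\<rfloor> = n div 2 - 1"
proof -
  assume "n \<ge> 2"
  have "\<lfloor>real n / 2 - 1\<rfloor> = int n div 2 - 1"
    using floor_divide_of_nat_eq[of n 2, where ?'a = real] by (simp add: zdiv_int)
  then show ?thesis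
    using \<open>n \<ge> 2\<close> by (simp add: nat_diff_distrib' nat_div_distrib)
qed

theorem theorem1p6:
  shows "\<exists>C::real. C > 0 \<and>
    (\<forall>n::nat. n \<ge> 2 \<longrightarrow>
       real (height (M_K n)) > C * fact (nat \<lfloor>real n / 2 - 1\<rfloor>)) \<and>
    (\<forall>n::nat. n \<ge> 4 \<and> even n \<longrightarrow>
       real (height (PM_K n)) > C * fact (nat \<lfloor>real n / 2 - 1\<rfloor>)) \<and>
    (\<forall>n::nat. n \<ge> 2 \<longrightarrow>
       real (height (FM_K n)) > C * fact (nat \<lfloor>real n / 2 - 1\<rfloor>)) \<and>
    (\<forall>n::nat. n \<ge> 4 \<longrightarrow>
       real (height (FPM_K n)) > C * fact (nat \<lfloor>real n / 2 - 1\<rfloor>))"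
proof (intro exI[of _ "1 / 3"] conjI allI impI)
  have M: "1 / 3 * fact (nat \<lfloor>real n / 2 - 1\<rfloor>) < real (height Q)"
    if "2 \<le> n" "M_K n \<subseteq> Q" "Q \<subseteq> FM_K n" "convex Q" "finite (vertices Q)" for n Q
    unfolding nat_floor_half[OF that(1)]
    using that by (intro fact_bound height_M_K_ge[of "n div 2" n] height_M_K_pos) auto
  show "1 / 3 * fact (nat \<lfloor>real n / 2 - 1\<rfloor>) < real (height (M_K n))" if "2 \<le> n" for n
    using that by (intro M M_K_subset convex_M_K finite_vertices_M_K) auto
  show "1 / 3 * fact (nat \<lfloor>real n / 2 - 1\<rfloor>) < real (height (FM_K n))" if "2 \<le> n" for n
    using that by (intro M M_K_subset convex_FM_K finite_vertices_FM_K) auto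
  have PM: "1 / 3 * fact (nat \<lfloor>real n / 2 - 1\<rfloor>) < real (height Q)"
    if n: "4 \<le> n" "even n" and Q: "PM_K n \<subseteq> Q" "Q \<subseteq> FM_K n" "convex Q" "finite (vertices Q)" for n Q
  proof -
    obtain k where k: "n = 2 * k" "2 \<le> k"
      using n by (auto elim!: evenE)
    have "2 ^ (k - 1) * fact (k - 1) - 1 \<le> height Q"
      using Q k by (intro height_PM_K_ge) auto
    moreover have "2 ^ 1 * 1 \<le> 2 ^ (k - 1) * (fact (k - 1) :: nat)"
      using k by (intro mult_le_mono power_increasing) auto
    ultimately show ?thesis
      using fact_bound[of "k - 1" "height Q"] nat_floor_half[of n] k by simp
  qed
  show "1 / 3 * fact (nat \<lfloor>real n / 2 - 1\<rfloor>) < real (height (PM_K n))" if "4 \<le> n \<and> even n" for n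
    using that PM_K_subset_FPM_K FPM_K_subset
    by (intro PM convex_PM_K finite_vertices_PM_K order.refl) blast+
  show "1 / 3 * fact (nat \<lfloor>real n / 2 - 1\<rfloor>) < real (height (FPM_K n))" if n: "4 \<le> n" for n
  proof (cases "even n")
    case True
    then show ?thesis
      using n by (intro PM convex_FPM_K finite_vertices_FPM_K PM_K_subset_FPM_K FPM_K_subset)
  next
    case False
    then obtain j where "n = 2 * j + 1"
      by (auto elim!: oddE)
    \<comment> \<open>An odd \<open>n\<close> with \<open>n \<ge> 4\<close> is at least 5, so a
      nonempty even part remains beside the triangle.\<close>
    then obtain k where k: "n = 2 * k + 3" "k > 0"
      using n by (intro that[of "j - 1"]) auto
    have ge: "2 ^ (k - 1) * fact (k - 1) - 1 \<le> height (FPM_K n)"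
      unfolding k(1) by (rule height_FPM_K_odd_ge) fact
    have "1 \<le> height (FPM_K n)"
    proof (cases "k = 1")
      case True
      then show ?thesis
        using height_FPM_K_5 k(1) by (simp add: numeral_eq_Suc)
    next
      case False
      then have "2 ^ 1 * 1 \<le> 2 ^ (k - 1) * (fact (k - 1) :: nat)"
        using k by (intro mult_le_mono power_increasing) auto
      from order_trans[OF diff_le_mono[OF this] ge] show ?thesis
        by simp
    qed
    from fact_bound_odd[OF ge this k(2)] show ?thesis
      using nat_floor_half[of n] k by simp
  qed
qed simp

end
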